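(* Let $$\Omega^1=\{\alpha\,d\boldsymbol z\,\alpha'+\beta\,d\overline{\boldsymbol z}\,\beta':\ \alpha,\alpha',\beta,\beta'\in C^\infty_q(\overline\Gamma)\}.$$ Then $(\Omega^1,d)$ is a first order differential $*$-calculus over $C^\infty_q(\overline\Gamma)$.
   Context: Fix $0<q<1$; $\Gamma=\{z\in\mathbb C:|z|\in q^{\mathbb Z}\}$, $\overline\Gamma=\Gamma\cup\{0\}$. $\mathscr B$ is the algebra of all continuous functions on $\overline\Gamma$ which can be continued analytically from any circle $\{z\in\overline\Gamma:|z|=q^n\}$ to a holomorphic function on $\mathbb C\setminus\{0\}$; it carries the involution given by complex conjugation. For $f\in\mathscr B$ and $z\in\overline\Gamma$ the function $\mathbb R\ni t\mapsto f(q^{it}z)$ has a continuation to an entire function; its value at $t=-i$ is denoted $f(q\cdot z)$ and its value at $t=i$ is denoted $f(q^{-1}\cdot z)$. Expressions such as $f(q\cdot q^{-1}z)$ denote the value of $w\mapsto f(q\cdot w)$ at $w=q^{-1}z$, etc. The function $z\mapsto z$ is denoted $\boldsymbol z$ and its complex conjugate $\overline{\boldsymbol z}$; both belong to $\mathscr B$. $\widetilde\Omega$ is the $\mathscr B$-bimodule generated by two elements $\omega,\overline\omega$ with the defining relations $$\omega f(z)=f(q\cdot qz)\,\omega,\qquad \overline\omega f(z)=f(q\cdot q^{-1}z)\,\overline\omega\qquad\text{for all } f\in\mathscr B$$ (where $f(z)$ is written for $f$). Putting $\omega^*=\overline\omega$ gives a $\mathscr B$-$*$-bimodule structure on $\widetilde\Omega$.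 The operator $d:\mathscr B\to\widetilde\Omega$ is defined by $$df=[\omega-\overline\omega,f]=(\omega-\overline\omega)f-f(\omega-\overline\omega).$$ For $z\ne0$ put $$\frac{\partial_R f}{\partial\boldsymbol z}=\frac{f(q^{-1}\cdot q^{-1}z)-f(z)}{(q^{-2}-1)z},\quad \frac{\partial_L f}{\partial\boldsymbol z}=\frac{f(z)-f(q\cdot qz)}{(1-q^2)z},$$ $$\frac{\partial_L f}{\partial\overline{\boldsymbol z}}=\frac{f(q\cdot q^{-1}z)-f(z)}{(q^{-2}-1)\overline z},\quad \frac{\partial_R f}{\partial\overline{\boldsymbol z}}=\frac{f(z)-f(q^{-1}\cdot qz)}{(1-q^2)\overline z}.$$ $C^\infty_q(\overline\Gamma)$ is the set of those $f\in\mathscr B$ such that $\lim_{\Gamma\ni z\to0}Df(z)$ exists for any product $D$ of these four operators; it is a unital $*$-algebra. A first order differential $*$-calculus over a unital $*$-algebra $\mathcal C$ is a pair $(\Omega,d)$ where $\Omega$ is a $\mathcal C$-bimodule with a compatible antilinear involution, $(f\rho g)^*=g^*\rho^*f^*$, and $d:\mathcal C\to\Omega$ is linear with $d(fg)=df\,g+f\,dg$, $d(f^* )=(df)^*$, and $\Omega$ is spanned by the elements $f\,dg$, $f,g\in\mathcal C$. Here $d$ is restricted to $C^\infty_q(\overline\Gamma)$.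
   Formalization: The algebra 𝓑 is not stable under f ↦ f(q·qz) and f ↦ f(q·q⁻¹z), so the defining relations of Ω̃ are imposed only for those f ∈ 𝓑 whose twisted function again lies in 𝓑; this includes all f in C^∞_q. *)

theory Defs
  imports
    "HOL-Analysis.Analysis"
    "HOL-Algebra.Module"
    "HOL-Algebra.Free_Abelian_Groups"
begin

section \<open>Differential calculi over complex unital *-algebras\<close>

record 'a star_algebra = "(complex, 'a) module" +
  star :: "'a \<Rightarrow> 'a"

locale complex_star_algebra = ring A for A (structure) +
  assumes smult_closed: "f \<in> carrier A \<Longrightarrow> c \<odot>\<^bsub>A\<^esub> f \<in> carrier A"
    and smult_add_left: "f \<in> carrier A \<Longrightarrow> (c + c') \<odot>\<^bsub>A\<^esub> f = c \<odot>\<^bsub>A\<^esub> f \<oplus>\<^bsub>A\<^esub> c' \<odot>\<^bsub>A\<^esub> f"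
    and smult_add_right: "\<lbrakk>f \<in> carrier A; g \<in> carrier A\<rbrakk> \<Longrightarrow>
          c \<odot>\<^bsub>A\<^esub> (f \<oplus>\<^bsub>A\<^esub> g) = c \<odot>\<^bsub>A\<^esub> f \<oplus>\<^bsub>A\<^esub> c \<odot>\<^bsub>A\<^esub> g"
    and smult_smult: "f \<in> carrier A \<Longrightarrow> c \<odot>\<^bsub>A\<^esub> (c' \<odot>\<^bsub>A\<^esub> f) = (c * c') \<odot>\<^bsub>A\<^esub> f"
    and smult_one: "f \<in> carrier A \<Longrightarrow> 1 \<odot>\<^bsub>A\<^esub> f = f"
    and smult_mult_left: "\<lbrakk>f \<in> carrier A; g \<in> carrier A\<rbrakk> \<Longrightarrow>
          (c \<odot>\<^bsub>A\<^esub> f) \<otimes>\<^bsub>A\<^esub> g = c \<odot>\<^bsub>A\<^esub> (f \<otimes>\<^bsub>A\<^esub> g)"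
    and smult_mult_right: "\<lbrakk>f \<in> carrier A; g \<in> carrier A\<rbrakk> \<Longrightarrow>
          f \<otimes>\<^bsub>A\<^esub> (c \<odot>\<^bsub>A\<^esub> g) = c \<odot>\<^bsub>A\<^esub> (f \<otimes>\<^bsub>A\<^esub> g)"
    and star_closed: "f \<in> carrier A \<Longrightarrow> star A f \<in> carrier A"
    and star_star: "f \<in> carrier A \<Longrightarrow> star A (star A f) = f"
    and star_add: "\<lbrakk>f \<in> carrier A; g \<in> carrier A\<rbrakk> \<Longrightarrow> star A (f \<oplus>\<^bsub>A\<^esub> g) = star A f \<oplus>\<^bsub>A\<^esub> star A g"
    and star_smult: "f \<in> carrier A \<Longrightarrow> star A (c \<odot>\<^bsub>A\<^esub> f) = cnj c \<odot>\<^bsub>A\<^esub> star A f"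
    and star_mult: "\<lbrakk>f \<in> carrier A; g \<in> carrier A\<rbrakk> \<Longrightarrow> star A (f \<otimes>\<^bsub>A\<^esub> g) = star A g \<otimes>\<^bsub>A\<^esub> star A f"

text \<open>
  As for modules in HOL-Algebra, only the additive part of the underlying ring record is used.
  The complex scalar multiplication of a bimodule over a unital algebra is the action of the
  multiples of the unit, which must be the same from the left and from the right.
\<close>

record ('a, 'm) star_bimodule = "'m ring" +
  lact :: "'a \<Rightarrow> 'm \<Rightarrow> 'm" (infixr \<open>\<triangleright>\<index>\<close> 70)
  ract :: "'m \<Rightarrow> 'a \<Rightarrow> 'm" (infixl \<open>\<triangleleft>\<index>\<close> 70)
  invol :: "'m \<Rightarrow> 'm"

locale star_bimodule = A: complex_star_algebra A + M: abelian_group M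
  for A :: "('a, 'x) star_algebra_scheme" and M :: "('a, 'm, 'y) star_bimodule_scheme" +
  assumes lact_closed: "\<lbrakk>f \<in> carrier A; \<rho> \<in> carrier M\<rbrakk> \<Longrightarrow> f \<triangleright>\<^bsub>M\<^esub> \<rho> \<in> carrier M"
    and ract_closed: "\<lbrakk>f \<in> carrier A; \<rho> \<in> carrier M\<rbrakk> \<Longrightarrow> \<rho> \<triangleleft>\<^bsub>M\<^esub> f \<in> carrier M"
    and lact_add_left: "\<lbrakk>f \<in> carrier A; g \<in> carrier A; \<rho> \<in> carrier M\<rbrakk> \<Longrightarrow>
          (f \<oplus>\<^bsub>A\<^esub> g) \<triangleright>\<^bsub>M\<^esub> \<rho> = (f \<triangleright>\<^bsub>M\<^esub> \<rho>) \<oplus>\<^bsub>M\<^esub> (g \<triangleright>\<^bsub>M\<^esub> \<rho>)"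
    and lact_add_right: "\<lbrakk>f \<in> carrier A; \<rho> \<in> carrier M; \<sigma> \<in> carrier M\<rbrakk> \<Longrightarrow>
          f \<triangleright>\<^bsub>M\<^esub> (\<rho> \<oplus>\<^bsub>M\<^esub> \<sigma>) = (f \<triangleright>\<^bsub>M\<^esub> \<rho>) \<oplus>\<^bsub>M\<^esub> (f \<triangleright>\<^bsub>M\<^esub> \<sigma>)"
    and ract_add_left: "\<lbrakk>f \<in> carrier A; \<rho> \<in> carrier M; \<sigma> \<in> carrier M\<rbrakk> \<Longrightarrow>
          (\<rho> \<oplus>\<^bsub>M\<^esub> \<sigma>) \<triangleleft>\<^bsub>M\<^esub> f = (\<rho> \<triangleleft>\<^bsub>M\<^esub> f) \<oplus>\<^bsub>M\<^esub> (\<sigma> \<triangleleft>\<^bsub>M\<^esub> f)"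
    and ract_add_right: "\<lbrakk>f \<in> carrier A; g \<in> carrier A; \<rho> \<in> carrier M\<rbrakk> \<Longrightarrow>
          \<rho> \<triangleleft>\<^bsub>M\<^esub> (f \<oplus>\<^bsub>A\<^esub> g) = (\<rho> \<triangleleft>\<^bsub>M\<^esub> f) \<oplus>\<^bsub>M\<^esub> (\<rho> \<triangleleft>\<^bsub>M\<^esub> g)"
    and lact_mult: "\<lbrakk>f \<in> carrier A; g \<in> carrier A; \<rho> \<in> carrier M\<rbrakk> \<Longrightarrow>
          (f \<otimes>\<^bsub>A\<^esub> g) \<triangleright>\<^bsub>M\<^esub> \<rho> = f \<triangleright>\<^bsub>M\<^esub> (g \<triangleright>\<^bsub>M\<^esub> \<rho>)"
    and ract_mult: "\<lbrakk>f \<in> carrier A; g \<in> carrier A; \<rho> \<in> carrier M\<rbrakk> \<Longrightarrow>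
          \<rho> \<triangleleft>\<^bsub>M\<^esub> (f \<otimes>\<^bsub>A\<^esub> g) = (\<rho> \<triangleleft>\<^bsub>M\<^esub> f) \<triangleleft>\<^bsub>M\<^esub> g"
    and lact_one: "\<rho> \<in> carrier M \<Longrightarrow> \<one>\<^bsub>A\<^esub> \<triangleright>\<^bsub>M\<^esub> \<rho> = \<rho>"
    and ract_one: "\<rho> \<in> carrier M \<Longrightarrow> \<rho> \<triangleleft>\<^bsub>M\<^esub> \<one>\<^bsub>A\<^esub> = \<rho>"
    and lact_ract: "\<lbrakk>f \<in> carrier A; g \<in> carrier A; \<rho> \<in> carrier M\<rbrakk> \<Longrightarrow>
          (f \<triangleright>\<^bsub>M\<^esub> \<rho>) \<triangleleft>\<^bsub>M\<^esub> g = f \<triangleright>\<^bsub>M\<^esub> (\<rho> \<triangleleft>\<^bsub>M\<^esub> g)"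
    and scalar_central: "\<rho> \<in> carrier M \<Longrightarrow>
          (c \<odot>\<^bsub>A\<^esub> \<one>\<^bsub>A\<^esub>) \<triangleright>\<^bsub>M\<^esub> \<rho> = \<rho> \<triangleleft>\<^bsub>M\<^esub> (c \<odot>\<^bsub>A\<^esub> \<one>\<^bsub>A\<^esub>)"
    and invol_closed: "\<rho> \<in> carrier M \<Longrightarrow> invol M \<rho> \<in> carrier M"
    and invol_invol: "\<rho> \<in> carrier M \<Longrightarrow> invol M (invol M \<rho>) = \<rho>"
    and invol_add: "\<lbrakk>\<rho> \<in> carrier M; \<sigma> \<in> carrier M\<rbrakk> \<Longrightarrow>
          invol M (\<rho> \<oplus>\<^bsub>M\<^esub> \<sigma>) = invol M \<rho> \<oplus>\<^bsub>M\<^esub> invol M \<sigma>"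
    and invol_scalar: "\<rho> \<in> carrier M \<Longrightarrow>
          invol M ((c \<odot>\<^bsub>A\<^esub> \<one>\<^bsub>A\<^esub>) \<triangleright>\<^bsub>M\<^esub> \<rho>) = (cnj c \<odot>\<^bsub>A\<^esub> \<one>\<^bsub>A\<^esub>) \<triangleright>\<^bsub>M\<^esub> invol M \<rho>"
    and invol_act: "\<lbrakk>f \<in> carrier A; g \<in> carrier A; \<rho> \<in> carrier M\<rbrakk> \<Longrightarrow>
          invol M ((f \<triangleright>\<^bsub>M\<^esub> \<rho>) \<triangleleft>\<^bsub>M\<^esub> g) = (star A g \<triangleright>\<^bsub>M\<^esub> invol M \<rho>) \<triangleleft>\<^bsub>M\<^esub> star A f"

text \<open>
  In the spanning axiom scalar coefficients are absorbed into the functions \<open>f i\<close>.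
\<close>

locale first_order_star_calculus = star_bimodule A M
  for A :: "('a, 'x) star_algebra_scheme" and M :: "('a, 'm, 'y) star_bimodule_scheme" +
  fixes d :: "'a \<Rightarrow> 'm"
  assumes d_closed: "f \<in> carrier A \<Longrightarrow> d f \<in> carrier M"
    and d_add: "\<lbrakk>f \<in> carrier A; g \<in> carrier A\<rbrakk> \<Longrightarrow> d (f \<oplus>\<^bsub>A\<^esub> g) = d f \<oplus>\<^bsub>M\<^esub> d g"
    and d_smult: "f \<in> carrier A \<Longrightarrow> d (c \<odot>\<^bsub>A\<^esub> f) = (c \<odot>\<^bsub>A\<^esub> \<one>\<^bsub>A\<^esub>) \<triangleright>\<^bsub>M\<^esub> d f"
    and Leibniz: "\<lbrakk>f \<in> carrier A; g \<in> carrier A\<rbrakk> \<Longrightarrow>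
          d (f \<otimes>\<^bsub>A\<^esub> g) = (d f \<triangleleft>\<^bsub>M\<^esub> g) \<oplus>\<^bsub>M\<^esub> (f \<triangleright>\<^bsub>M\<^esub> d g)"
    and d_star: "f \<in> carrier A \<Longrightarrow> d (star A f) = invol M (d f)"
    and spanned: "\<rho> \<in> carrier M \<Longrightarrow>
          \<exists>(n::nat) f g. f \<in> {..<n} \<rightarrow> carrier A \<and> g \<in> {..<n} \<rightarrow> carrier A \<and>
            \<rho> = (\<Oplus>\<^bsub>M\<^esub>i\<in>{..<n}. f i \<triangleright>\<^bsub>M\<^esub> d (g i))"


section \<open>Bimodules presented by generators and twisted commutation relations\<close>

text \<open>
  The bimodule over \<open>A\<close> with generators \<open>x :: 'g\<close> and defining relations \<open>x f = (\<theta> x f) x\<close>.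
  The free bimodule on \<open>'g\<close> is the direct sum of copies of \<open>A \<otimes> A\<close>, one for each generator, the
  tensor product being taken over the complex numbers. It is realised as the free abelian group
  on the triples \<open>(a, x, b)\<close>, which stand for \<open>a x b\<close>, modulo biadditivity and balancing of
  scalars. The map \<open>\<theta> x\<close> need not preserve \<open>A\<close>: the relation \<open>x f = (\<theta> x f) x\<close> is an
  equation between elements of an \<open>A\<close>-bimodule, and is imposed, precisely for those \<open>f\<close> in \<open>A\<close>
  for which \<open>\<theta> x f\<close> lies in \<open>A\<close>.
\<close>

type_synonym ('a, 'g) formal_bimodule = "('a \<times> 'g \<times> 'a) \<Rightarrow>\<^sub>0 int"

definition formal_triples :: "('a, 'x) star_algebra_scheme \<Rightarrow> ('a \<times> 'g \<times> 'a) set" where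
  "formal_triples A = carrier A \<times> UNIV \<times> carrier A"

definition tensor_relators :: "('a, 'x) star_algebra_scheme \<Rightarrow> ('a, 'g) formal_bimodule set" where
  "tensor_relators A =
     {frag_of (a \<oplus>\<^bsub>A\<^esub> a', x, b) - frag_of (a, x, b) - frag_of (a', x, b) | a a' x b.
        a \<in> carrier A \<and> a' \<in> carrier A \<and> b \<in> carrier A} \<union>
     {frag_of (a, x, b \<oplus>\<^bsub>A\<^esub> b') - frag_of (a, x, b) - frag_of (a, x, b') | a x b b'.
        a \<in> carrier A \<and> b \<in> carrier A \<and> b' \<in> carrier A} \<union>
     {frag_of (c \<odot>\<^bsub>A\<^esub> a, x, b) - frag_of (a, x, c \<odot>\<^bsub>A\<^esub> b) | c a x b.
        a \<in> carrier A \<and> b \<in> carrier A}"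

definition twist_relators ::
    "('a, 'x) star_algebra_scheme \<Rightarrow> ('g \<Rightarrow> 'a \<Rightarrow> 'a) \<Rightarrow> ('a, 'g) formal_bimodule set" where
  "twist_relators A \<theta> =
     {frag_of (a, x, f \<otimes>\<^bsub>A\<^esub> b) - frag_of (a \<otimes>\<^bsub>A\<^esub> \<theta> x f, x, b) | a x f b.
        a \<in> carrier A \<and> b \<in> carrier A \<and> f \<in> carrier A \<and> \<theta> x f \<in> carrier A}"

definition presented_rel ::
    "('a, 'x) star_algebra_scheme \<Rightarrow> ('g \<Rightarrow> 'a \<Rightarrow> 'a) \<Rightarrow> ('a, 'g) formal_bimodule rel" where
  "presented_rel A \<theta> =
     {(u, v). Poly_Mapping.keys u \<subseteq> formal_triples A \<and> Poly_Mapping.keys v \<subseteq> formal_triples A \<and>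
        u - v \<in> generate (free_Abelian_group (formal_triples A))
                   (tensor_relators A \<union> twist_relators A \<theta>)}"

definition presented_generator ::
    "('a, 'x) star_algebra_scheme \<Rightarrow> ('g \<Rightarrow> 'a \<Rightarrow> 'a) \<Rightarrow> 'g \<Rightarrow> ('a, 'g) formal_bimodule set" where
  "presented_generator A \<theta> x = presented_rel A \<theta> `` {frag_of (\<one>\<^bsub>A\<^esub>, x, \<one>\<^bsub>A\<^esub>)}"

text \<open>
  The involution sends \<open>a x b\<close> to \<open>b\<^sup>* (s x) a\<^sup>*\<close>; the map \<open>s\<close> prescribes it on the generators.
\<close>

definition presented_bimodule ::
    "('a, 'x) star_algebra_scheme \<Rightarrow> ('g \<Rightarrow> 'a \<Rightarrow> 'a) \<Rightarrow> ('g \<Rightarrow> 'g) \<Rightarrow>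
      ('a, ('a, 'g) formal_bimodule set) star_bimodule" where
  "presented_bimodule A \<theta> s =
     (let R = presented_rel A \<theta> in
      \<lparr>carrier = {u. Poly_Mapping.keys u \<subseteq> formal_triples A} // R,
       monoid.mult = undefined,
       monoid.one = undefined,
       ring.zero = R `` {0},
       ring.add = (\<lambda>X Y. \<Union>u\<in>X. \<Union>v\<in>Y. R `` {u + v}),
       lact = (\<lambda>f X. \<Union>u\<in>X. R `` {frag_extend (\<lambda>(a, x, b). frag_of (f \<otimes>\<^bsub>A\<^esub> a, x, b)) u}),
       ract = (\<lambda>X f. \<Union>u\<in>X. R `` {frag_extend (\<lambda>(a, x, b). frag_of (a, x, b \<otimes>\<^bsub>A\<^esub> f)) u}),
       invol = (\<lambda>X. \<Union>u\<in>X. R `` {frag_extend (\<lambda>(a, x, b). frag_of (star A b, s x, star A a)) u})\<rparr>)"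


section \<open>The algebras of functions\<close>

definition Gam :: "real \<Rightarrow> complex set" where
  "Gam q = {z. \<exists>n::int. norm z = q powi n}"

definition Gam_bar :: "real \<Rightarrow> complex set" where
  "Gam_bar q = insert 0 (Gam q)"

text \<open>
  Functions on \<open>Gam_bar q\<close> are represented by functions on the complex plane that vanish
  outside \<open>Gam_bar q\<close>.
\<close>

definition B_set :: "real \<Rightarrow> (complex \<Rightarrow> complex) set" where
  "B_set q = {f. (\<forall>z. z \<notin> Gam_bar q \<longrightarrow> f z = 0) \<and> continuous_on (Gam_bar q) f \<and>
     (\<forall>n::int. \<exists>h. h holomorphic_on (- {0}) \<and> (\<forall>z. norm z = q powi n \<longrightarrow> h z = f z))}"

definition fun_star_algebra ::
    "real \<Rightarrow> (complex \<Rightarrow> complex) set \<Rightarrow> (complex \<Rightarrow> complex) star_algebra" where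
  "fun_star_algebra q S =
     \<lparr>carrier = S,
      monoid.mult = (\<lambda>f g z. f z * g z),
      monoid.one = (\<lambda>z. if z \<in> Gam_bar q then 1 else 0),
      ring.zero = (\<lambda>z. 0),
      ring.add = (\<lambda>f g z. f z + g z),
      module.smult = (\<lambda>c f z. c * f z),
      star = (\<lambda>f z. cnj (f z))\<rparr>"

definition B_alg :: "real \<Rightarrow> (complex \<Rightarrow> complex) star_algebra" where
  "B_alg q = fun_star_algebra q (B_set q)"

definition orbit_extension ::
    "real \<Rightarrow> (complex \<Rightarrow> complex) \<Rightarrow> complex \<Rightarrow> complex \<Rightarrow> complex" where
  "orbit_extension q f z =
     (THE h. h holomorphic_on UNIV \<and>
        (\<forall>t::real. h (of_real t) = f (of_real q powr (\<i> * of_real t) * z)))"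

text \<open>\<open>qdot q f z\<close> is \<open>f(q\<cdot>z)\<close>, and \<open>qdot_inv q f z\<close> is \<open>f(q\<^sup>-\<^sup>1\<cdot>z)\<close>.\<close>

definition qdot :: "real \<Rightarrow> (complex \<Rightarrow> complex) \<Rightarrow> complex \<Rightarrow> complex" where
  "qdot q f z = orbit_extension q f z (- \<i>)"

definition qdot_inv :: "real \<Rightarrow> (complex \<Rightarrow> complex) \<Rightarrow> complex \<Rightarrow> complex" where
  "qdot_inv q f z = orbit_extension q f z \<i>"

definition bz :: "real \<Rightarrow> complex \<Rightarrow> complex" where
  "bz q = (\<lambda>z. if z \<in> Gam_bar q then z else 0)"

definition bzbar :: "real \<Rightarrow> complex \<Rightarrow> complex" where
  "bzbar q = (\<lambda>z. if z \<in> Gam_bar q then cnj z else 0)"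

text \<open>
  The \<open>q\<close>-derivatives are meant for \<open>z \<noteq> 0\<close> only. The value at \<open>0\<close> (which is \<open>0\<close>, by division
  by zero) affects neither their iterates at \<open>z \<noteq> 0\<close> nor the limits at \<open>0\<close>.
\<close>

definition dR_z :: "real \<Rightarrow> (complex \<Rightarrow> complex) \<Rightarrow> complex \<Rightarrow> complex" where
  "dR_z q f z = (qdot_inv q f (z / of_real q) - f z) / ((of_real (q powi (-2)) - 1) * z)"

definition dL_z :: "real \<Rightarrow> (complex \<Rightarrow> complex) \<Rightarrow> complex \<Rightarrow> complex" where
  "dL_z q f z = (f z - qdot q f (of_real q * z)) / ((1 - of_real (q\<^sup>2)) * z)"

definition dL_zbar :: "real \<Rightarrow> (complex \<Rightarrow> complex) \<Rightarrow> complex \<Rightarrow> complex" where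
  "dL_zbar q f z = (qdot q f (z / of_real q) - f z) / ((of_real (q powi (-2)) - 1) * cnj z)"

definition dR_zbar :: "real \<Rightarrow> (complex \<Rightarrow> complex) \<Rightarrow> complex \<Rightarrow> complex" where
  "dR_zbar q f z = (f z - qdot_inv q f (of_real q * z)) / ((1 - of_real (q\<^sup>2)) * cnj z)"

definition Cinf_set :: "real \<Rightarrow> (complex \<Rightarrow> complex) set" where
  "Cinf_set q = {f \<in> B_set q. \<forall>Ds \<in> lists {dR_z q, dL_z q, dL_zbar q, dR_zbar q}.
     \<exists>L. (foldr (\<circ>) Ds id f \<longlongrightarrow> L) (at 0 within Gam q)}"

definition Cinf_alg :: "real \<Rightarrow> (complex \<Rightarrow> complex) star_algebra" where
  "Cinf_alg q = fun_star_algebra q (Cinf_set q)"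


section \<open>The differential calculus\<close>

datatype form_gen = Om | Om_bar

fun form_conj :: "form_gen \<Rightarrow> form_gen" where
  "form_conj Om = Om_bar"
| "form_conj Om_bar = Om"

fun form_twist :: "real \<Rightarrow> form_gen \<Rightarrow> (complex \<Rightarrow> complex) \<Rightarrow> complex \<Rightarrow> complex" where
  "form_twist q Om f = (\<lambda>z. qdot q f (of_real q * z))"
| "form_twist q Om_bar f = (\<lambda>z. qdot q f (z / of_real q))"

type_synonym qform = "((complex \<Rightarrow> complex), form_gen) formal_bimodule set"

text \<open>
  The algebra \<open>B_alg q\<close> is not invariant under the two twists. For instance, if
  \<open>f(z) = c n * (z / q^n)^(- k n)\<close> on the circle of radius \<open>q^n\<close>, \<open>n \<ge> 0\<close>, and \<open>f = 0\<close> elsewhere,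
  with \<open>c n\<close> tending to \<open>0\<close> and \<open>k n\<close> tending to infinity sufficiently fast, then \<open>f\<close> lies in the
  algebra but \<open>f(q\<cdot>qz)\<close> is unbounded near \<open>0\<close>. Thus the relation \<open>\<omega> f(z) = f(q\<cdot>qz) \<omega>\<close> is
  imposed whenever it makes sense, that is, if both \<open>f\<close> and \<open>f(q\<cdot>qz)\<close> are in the algebra, as
  is the case for all \<open>f \<in> Cinf_set q\<close>; the same applies to the conjugate generator.
\<close>

definition Omega_tilde :: "real \<Rightarrow> (complex \<Rightarrow> complex, qform) star_bimodule" where
  "Omega_tilde q = presented_bimodule (B_alg q) (form_twist q) form_conj"

definition \<omega> :: "real \<Rightarrow> qform" where
  "\<omega> q = presented_generator (B_alg q) (form_twist q) Om"

definition \<omega>_bar :: "real \<Rightarrow> qform" where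
  "\<omega>_bar q = presented_generator (B_alg q) (form_twist q) Om_bar"

definition qd :: "real \<Rightarrow> (complex \<Rightarrow> complex) \<Rightarrow> qform" where
  "qd q f = ((\<omega> q \<ominus>\<^bsub>Omega_tilde q\<^esub> \<omega>_bar q) \<triangleleft>\<^bsub>Omega_tilde q\<^esub> f) \<ominus>\<^bsub>Omega_tilde q\<^esub>
            (f \<triangleright>\<^bsub>Omega_tilde q\<^esub> (\<omega> q \<ominus>\<^bsub>Omega_tilde q\<^esub> \<omega>_bar q))"

definition Omega1_set :: "real \<Rightarrow> qform set" where
  "Omega1_set q =
     {((\<alpha> \<triangleright>\<^bsub>Omega_tilde q\<^esub> qd q (bz q)) \<triangleleft>\<^bsub>Omega_tilde q\<^esub> \<alpha>') \<oplus>\<^bsub>Omega_tilde q\<^esub>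
      ((\<beta> \<triangleright>\<^bsub>Omega_tilde q\<^esub> qd q (bzbar q)) \<triangleleft>\<^bsub>Omega_tilde q\<^esub> \<beta>') | \<alpha> \<alpha>' \<beta> \<beta>'.
        \<alpha> \<in> Cinf_set q \<and> \<alpha>' \<in> Cinf_set q \<and> \<beta> \<in> Cinf_set q \<and> \<beta>' \<in> Cinf_set q}"

definition Omega1 :: "real \<Rightarrow> (complex \<Rightarrow> complex, qform) star_bimodule" where
  "Omega1 q = Omega_tilde q \<lparr>carrier := Omega1_set q\<rparr>"

end

(*
  On the circle of radius q^n the function f(q^e . q^k z) is h(q^(e+k) z), where h is the holomorphic
  continuation of f from the circle of radius q^(n+k). So the operators T : f -> f(q^e . q^k z) are
  algebra automorphisms and each of the four q-derivatives has the form D f = (f - T f) / (c w), with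
  w one of the two coordinates. The twisted Leibniz rule D(f g) = (D f) g + (T f) (D g) and the relation
  T f = f - c w D f show that the smooth functions form a *-algebra that is stable under T and under D,
  the value of D f at 0 being its limit.

  By the relations, d f = (T f - f) omega - (T' f - f) omega_bar. Hence dz is a multiple of z omega and
  d(z bar) of (z bar) omega_bar, dz f = (T f) dz and similarly for z bar, and
  d f = (D f) dz + (D' f) d(z bar). All coefficients can thus be moved to the left, which makes the
  one-forms a *-bimodule spanned by dz and d(z bar).
*)
theory Submission
  imports Defs "HOL-Complex_Analysis.Conformal_Mappings"
begin

section \<open>Bimodules presented by twisted commutation relations\<close>

text \<open>The algebra \<open>B_set q\<close> is not stable under the twists, so a commutation
  relation is available only for a function whose twist lies in \<open>B_set q\<close> again.
  Smoothness is therefore settled before any computation with forms: for smooth f the twist is f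
  plus a product of smooth functions. No normal form for the presented bimodule is computed; only
  its relations and the bimodule axioms enter.

  The twists of the two generators are those of the left derivatives, which thus supply the
  coefficients of df. The right derivatives come in through the star, which turns f(q.) into
  f(q^-1.) and exchanges left and right derivatives.

  The origin is the second obstacle. A q-derivative has the default value 0 there, so the
  intermediate statements disregard the value at 0, and it is replaced by the limit only when a
  coefficient has to lie in the algebra. The coordinate factor of T f - f vanishes at 0, so this
  repair leaves the identities intact.\<close>

lemma keys_add_subset:
  "Poly_Mapping.keys (u + v) \<subseteq> S" if "Poly_Mapping.keys u \<subseteq> S" "Poly_Mapping.keys v \<subseteq> S"
    for u v :: "'b \<Rightarrow>\<^sub>0 int"
  using that keys_add[of u v] by blast

lemma keys_frag_extend_subset:
  assumes "Poly_Mapping.keys c \<subseteq> S" and "\<And>t. t \<in> S \<Longrightarrow> Poly_Mapping.keys (f t) \<subseteq> S'"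
  shows "Poly_Mapping.keys (frag_extend f c) \<subseteq> S'"
  using keys_frag_extend[of f c] assms by blast

lemma (in complex_star_algebra) star_one: "star A \<one> = \<one>"
  using star_mult[of "star A \<one>" "\<one>"] by (simp add: star_star star_closed)

text \<open>Adjoining x f = (\<open>\<theta> x f\<close>) x gives f* (s x) = (s x)
  (\<open>\<theta> x f\<close>)*. The assumption \<open>twist_star\<close> makes this again a
  defining relation, the one of s x for the adjoint of \<open>\<theta> x f\<close>, so that the
  involution descends to the quotient.\<close>

locale twisted_presentation = complex_star_algebra A
  for A :: "('a, 'x) star_algebra_scheme" (structure) +
  fixes \<theta> :: "'g \<Rightarrow> 'a \<Rightarrow> 'a" and s :: "'g \<Rightarrow> 'g"
  assumes s_s: "s (s x) = x"
    and twist_star: "\<lbrakk>f \<in> carrier A; \<theta> x f \<in> carrier A\<rbrakk> \<Longrightarrow> \<theta> (s x) (star A (\<theta> x f)) = star A f"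
begin

abbreviation "relators \<equiv> tensor_relators A \<union> twist_relators A \<theta>"
definition "null_forms = generate (free_Abelian_group (formal_triples A)) relators"
definition "cls u = presented_rel A \<theta> `` {u}"
abbreviation "PB \<equiv> presented_bimodule A \<theta> s"
definition "formal_lact f = frag_extend (\<lambda>(a, x, b). frag_of (f \<otimes>\<^bsub>A\<^esub> a, x, b))"
definition "formal_ract f = frag_extend (\<lambda>(a, x, b). frag_of (a, x, b \<otimes>\<^bsub>A\<^esub> f))"
definition "formal_invol = frag_extend (\<lambda>(a, x, b). frag_of (star A b, s x, star A a))"

lemma relators_in_carrier: "relators \<subseteq> carrier (free_Abelian_group (formal_triples A))"
  unfolding tensor_relators_def twist_relators_def formal_triples_def
  by (auto simp: smult_closed dest!: subsetD[OF keys_diff])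

lemma null_forms_keys: "u \<in> null_forms \<Longrightarrow> Poly_Mapping.keys u \<subseteq> formal_triples A"
  using group.generate_in_carrier[OF group_free_Abelian_group relators_in_carrier]
  by (auto simp: null_forms_def)

lemma null_forms_subgroup: "subgroup null_forms (free_Abelian_group (formal_triples A))"
  unfolding null_forms_def by (rule group.generate_is_subgroup[OF group_free_Abelian_group relators_in_carrier])

lemma null_forms_0: "0 \<in> null_forms"
  using subgroup.one_closed[OF null_forms_subgroup] by simp

lemma null_forms_add: "u \<in> null_forms \<Longrightarrow> v \<in> null_forms \<Longrightarrow> u + v \<in> null_forms"
  using subgroup.m_closed[OF null_forms_subgroup] by simp

lemma null_forms_uminus: "u \<in> null_forms \<Longrightarrow> - u \<in> null_forms"
  using subgroup.m_inv_closed[OF null_forms_subgroup, of u] null_forms_keys[of u] by simp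

lemma null_forms_diff: "u \<in> null_forms \<Longrightarrow> v \<in> null_forms \<Longrightarrow> u - v \<in> null_forms"
  using null_forms_add[OF _ null_forms_uminus, of u v] by simp

lemma relator_null: "u \<in> relators \<Longrightarrow> u \<in> null_forms"
  unfolding null_forms_def by (rule generate.incl)

text \<open>Differences cover the whole generated subgroup: an inverse is 0 - h and a sum is h1 - (0
  - h2). An additive map hence preserves \<open>null_forms\<close> once it sends every relator
  there.\<close>

lemma null_forms_induct [consumes 1, case_names zero relator diff]:
  assumes "u \<in> null_forms" and "P 0" and "\<And>r. r \<in> relators \<Longrightarrow> P r"
    and "\<And>u v. P u \<Longrightarrow> P v \<Longrightarrow> P (u - v)"
  shows "P u"
  using assms(1) unfolding null_forms_def
proof (induction rule: generate.induct)
  case one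
  then show ?case using assms(2) by simp
next
  case (incl h)
  then show ?case using assms(3) by blast
next
  case (inv h)
  moreover have "h \<in> carrier (free_Abelian_group (formal_triples A))"
    using inv relators_in_carrier by blast
  ultimately show ?case using assms(4)[OF assms(2) assms(3)[OF inv]] by simp
next
  case (eng h1 h2)
  then show ?case using assms(4)[of h1 "0 - h2"] assms(4)[OF assms(2), of h2] by simp
qed

section \<open>Congruence modulo null forms\<close>

lemma presented_rel_iff:
  "(u, v) \<in> presented_rel A \<theta> \<longleftrightarrow>
     Poly_Mapping.keys u \<subseteq> formal_triples A \<and> Poly_Mapping.keys v \<subseteq> formal_triples A \<and> u - v \<in> null_forms"
  by (simp add: presented_rel_def null_forms_def)

lemma keys_transfer:
  assumes "u - v \<in> null_forms" "Poly_Mapping.keys v \<subseteq> formal_triples A"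
  shows "Poly_Mapping.keys u \<subseteq> formal_triples A"
  using null_forms_keys[OF assms(1)] assms(2) keys_add[of "u - v" v] by auto

lemma null_forms_commute: "u - v \<in> null_forms \<Longrightarrow> v - u \<in> null_forms"
  using null_forms_uminus[of "u - v"] by simp

lemma equiv_presented_rel:
  "equiv {u. Poly_Mapping.keys u \<subseteq> formal_triples A} (presented_rel A \<theta>)"
proof (rule equivI)
  show "presented_rel A \<theta> \<subseteq> {u. Poly_Mapping.keys u \<subseteq> formal_triples A} \<times> {u. Poly_Mapping.keys u \<subseteq> formal_triples A}"
    by (auto simp: presented_rel_iff)
  show "refl_on {u. Poly_Mapping.keys u \<subseteq> formal_triples A} (presented_rel A \<theta>)"
    by (auto simp: refl_on_def presented_rel_iff null_forms_0)
  show "sym (presented_rel A \<theta>)"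
    by (auto simp: sym_def presented_rel_iff intro: null_forms_commute)
  show "trans (presented_rel A \<theta>)"
  proof (rule transI)
    fix u v w assume "(u, v) \<in> presented_rel A \<theta>" "(v, w) \<in> presented_rel A \<theta>"
    then show "(u, w) \<in> presented_rel A \<theta>"
      using null_forms_add[of "u - v" "v - w"] by (simp add: presented_rel_iff)
  qed
qed

text \<open>Null forms are supported on \<open>formal_triples A\<close>, so u and v are either both
  supported there or both not; in the second case both classes are empty.\<close>

lemma cls_eqI:
  assumes "u - v \<in> null_forms" shows "cls u = cls v"
proof -
  have "(u, w) \<in> presented_rel A \<theta> \<longleftrightarrow> (v, w) \<in> presented_rel A \<theta>" for w
    using keys_transfer[OF assms] keys_transfer[OF null_forms_commute[OF assms]]
      null_forms_add[OF assms, of "v - w"] null_forms_add[OF null_forms_commute[OF assms], of "u - w"]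
    by (auto simp: presented_rel_iff)
  then show ?thesis by (auto simp: cls_def)
qed

lemma cls_carrier: "cls u \<in> carrier PB" if "Poly_Mapping.keys u \<subseteq> formal_triples A"
  using that by (auto simp: presented_bimodule_def Let_def cls_def intro: quotientI)

lemma carrier_cases:
  assumes "X \<in> carrier PB"
  obtains u where "Poly_Mapping.keys u \<subseteq> formal_triples A" "X = cls u"
  using assms by (auto simp: presented_bimodule_def Let_def cls_def elim!: quotientE)

section \<open>The actions and the involution on representatives\<close>

lemma formal_carrier:
  assumes "Poly_Mapping.keys u \<subseteq> formal_triples A"
  shows "f \<in> carrier A \<Longrightarrow> Poly_Mapping.keys (formal_lact f u) \<subseteq> formal_triples A"
    and "f \<in> carrier A \<Longrightarrow> Poly_Mapping.keys (formal_ract f u) \<subseteq> formal_triples A"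
    and "Poly_Mapping.keys (formal_invol u) \<subseteq> formal_triples A"
  unfolding formal_lact_def formal_ract_def formal_invol_def
  by (rule keys_frag_extend_subset[OF assms]; clarsimp simp: formal_triples_def star_closed)+

lemma formal_diff:
  "formal_lact f (u - v) = formal_lact f u - formal_lact f v"
  "formal_ract f (u - v) = formal_ract f u - formal_ract f v"
  "formal_invol (u - v) = formal_invol u - formal_invol v"
  "formal_lact f (u + v) = formal_lact f u + formal_lact f v"
  "formal_ract f (u + v) = formal_ract f u + formal_ract f v"
  "formal_invol (u + v) = formal_invol u + formal_invol v"
  "formal_lact f 0 = 0" "formal_ract f 0 = 0" "formal_invol 0 = 0"
  by (simp_all add: formal_lact_def formal_ract_def formal_invol_def frag_extend_diff frag_extend_add)

lemma formal_of [simp]: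
  "formal_lact f (frag_of (a, x, b)) = frag_of (f \<otimes>\<^bsub>A\<^esub> a, x, b)"
  "formal_ract f (frag_of (a, x, b)) = frag_of (a, x, b \<otimes>\<^bsub>A\<^esub> f)"
  "formal_invol (frag_of (a, x, b)) = frag_of (star A b, s x, star A a)"
  by (simp_all add: formal_lact_def formal_ract_def formal_invol_def)

lemma null_add_left: "\<lbrakk>a \<in> carrier A; a' \<in> carrier A; b \<in> carrier A\<rbrakk> \<Longrightarrow>
    frag_of (a \<oplus>\<^bsub>A\<^esub> a', x, b) - frag_of (a, x, b) - frag_of (a', x, b) \<in> null_forms"
  by (rule relator_null, rule UnI1, unfold tensor_relators_def, rule UnI1, rule UnI1, intro CollectI exI, rule conjI[OF refl], (intro conjI; assumption))

lemma null_add_right: "\<lbrakk>a \<in> carrier A; b \<in> carrier A; b' \<in> carrier A\<rbrakk> \<Longrightarrow>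
    frag_of (a, x, b \<oplus>\<^bsub>A\<^esub> b') - frag_of (a, x, b) - frag_of (a, x, b') \<in> null_forms"
  by (rule relator_null, rule UnI1, unfold tensor_relators_def, rule UnI1, rule UnI2, intro CollectI exI, rule conjI[OF refl], (intro conjI; assumption))

lemma null_balance: "\<lbrakk>a \<in> carrier A; b \<in> carrier A\<rbrakk> \<Longrightarrow>
    frag_of (c \<odot>\<^bsub>A\<^esub> a, x, b) - frag_of (a, x, c \<odot>\<^bsub>A\<^esub> b) \<in> null_forms"
  by (rule relator_null, rule UnI1, unfold tensor_relators_def, rule UnI2, intro CollectI exI, rule conjI[OF refl], (intro conjI; assumption))

lemma null_twist: "\<lbrakk>a \<in> carrier A; b \<in> carrier A; f \<in> carrier A; \<theta> x f \<in> carrier A\<rbrakk> \<Longrightarrow>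
    frag_of (a, x, f \<otimes>\<^bsub>A\<^esub> b) - frag_of (a \<otimes>\<^bsub>A\<^esub> \<theta> x f, x, b) \<in> null_forms"
  by (rule relator_null, rule UnI2, unfold twist_relators_def, intro CollectI exI, rule conjI[OF refl], (intro conjI; assumption))

lemma relator_cases [consumes 1, case_names add_left add_right balance twist]:
  assumes "r \<in> relators"
    and "\<And>a a' x b. \<lbrakk>a \<in> carrier A; a' \<in> carrier A; b \<in> carrier A\<rbrakk> \<Longrightarrow>
        P (frag_of (a \<oplus>\<^bsub>A\<^esub> a', x, b) - frag_of (a, x, b) - frag_of (a', x, b))"
    and "\<And>a x b b'. \<lbrakk>a \<in> carrier A; b \<in> carrier A; b' \<in> carrier A\<rbrakk> \<Longrightarrow>
        P (frag_of (a, x, b \<oplus>\<^bsub>A\<^esub> b') - frag_of (a, x, b) - frag_of (a, x, b'))"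
    and "\<And>c a x b. \<lbrakk>a \<in> carrier A; b \<in> carrier A\<rbrakk> \<Longrightarrow>
        P (frag_of (c \<odot>\<^bsub>A\<^esub> a, x, b) - frag_of (a, x, c \<odot>\<^bsub>A\<^esub> b))"
    and "\<And>a x f b. \<lbrakk>a \<in> carrier A; b \<in> carrier A; f \<in> carrier A; \<theta> x f \<in> carrier A\<rbrakk> \<Longrightarrow>
        P (frag_of (a, x, f \<otimes>\<^bsub>A\<^esub> b) - frag_of (a \<otimes>\<^bsub>A\<^esub> \<theta> x f, x, b))"
  shows "P r"
  using assms(1) unfolding tensor_relators_def twist_relators_def
  by (elim UnE CollectE exE conjE; hypsubst) (erule (2) assms(2), erule (2) assms(3),
      erule (1) assms(4), erule (3) assms(5))

text \<open>The left action changes only the left coefficient \<open>a\<close> of a triple, so each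
  relator goes to a relator of the same kind.\<close>

lemma formal_lact_null:
  assumes "u \<in> null_forms" "f \<in> carrier A" shows "formal_lact f u \<in> null_forms"
  using assms(1)
proof (induction rule: null_forms_induct)
  case (relator r)
  then show ?case
    by (induction rule: relator_cases)
      (use assms(2) in \<open>simp_all add: formal_diff r_distr smult_mult_right m_assoc[symmetric]
         null_add_left null_add_right null_balance null_twist\<close>)
qed (simp_all add: formal_diff null_forms_0 null_forms_diff)

lemma formal_ract_null:
  assumes "u \<in> null_forms" "f \<in> carrier A" shows "formal_ract f u \<in> null_forms"
  using assms(1)
proof (induction rule: null_forms_induct)
  case (relator r)
  then show ?case
    by (induction rule: relator_cases)
      (use assms(2) in \<open>simp_all add: formal_diff l_distr smult_mult_left m_assoc
         null_add_left null_add_right null_balance null_twist\<close>)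
qed (simp_all add: formal_diff null_forms_0 null_forms_diff)

text \<open>The involution interchanges the two kinds of additivity relators, sends the balancing
  relator of c to minus that of \<open>cnj c\<close>, and sends the twist relator of x and f to
  minus that of \<open>s x\<close> and the adjoint of \<open>\<theta> x f\<close>.\<close>

lemma formal_invol_null:
  assumes "u \<in> null_forms" shows "formal_invol u \<in> null_forms"
  using assms
proof (induction rule: null_forms_induct)
  case (relator r)
  then show ?case
  proof (induction rule: relator_cases)
    case (balance c a x b)
    then show ?case
      using null_forms_commute[OF null_balance[of "star A b" "star A a" "cnj c" "s x"]]
      by (simp add: formal_diff star_smult star_closed)
  next
    case (twist a x f b)
    then show ?case
      using null_forms_commute[OF null_twist[of "star A b" "star A a" "star A (\<theta> x f)" "s x"]]
      by (simp add: formal_diff star_mult star_closed twist_star)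
  qed (simp_all add: formal_diff star_add star_closed null_add_left null_add_right)
qed (simp_all add: formal_diff null_forms_0 null_forms_diff)

lemma add_cls:
  assumes "Poly_Mapping.keys u \<subseteq> formal_triples A" "Poly_Mapping.keys v \<subseteq> formal_triples A"
  shows "cls u \<oplus>\<^bsub>PB\<^esub> cls v = cls (u + v)"
proof -
  have "(\<lambda>u v. presented_rel A \<theta> `` {u + v}) respects2 presented_rel A \<theta>"
  proof (rule congruent2I'[of "presented_rel A \<theta>" "presented_rel A \<theta>"])
    fix u u' v v' assume "(u, u') \<in> presented_rel A \<theta>" "(v, v') \<in> presented_rel A \<theta>"
    then have "(u + v) - (u' + v') \<in> null_forms"
      using null_forms_add[of "u - u'" "v - v'"] by (simp add: presented_rel_iff algebra_simps)
    then show "presented_rel A \<theta> `` {u + v} = presented_rel A \<theta> `` {u' + v'}"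
      using cls_eqI unfolding cls_def by blast
  qed
  from UN_equiv_class2[OF equiv_presented_rel equiv_presented_rel this, of u v] show ?thesis
    using assms by (simp add: presented_bimodule_def Let_def cls_def)
qed

text \<open>Evaluates the unions over representatives in \<open>presented_bimodule\<close>: modulo
  null forms, F is constant on a class, so the union is over copies of a single class.\<close>

lemma lift_cls:
  assumes "\<And>u v. F (u - v) = F u - F v" and "\<And>u. u \<in> null_forms \<Longrightarrow> F u \<in> null_forms"
    and "Poly_Mapping.keys u \<subseteq> formal_triples A"
  shows "(\<Union>u \<in> cls u. presented_rel A \<theta> `` {F u}) = cls (F u)"
proof -
  have "(\<lambda>u. presented_rel A \<theta> `` {F u}) respects presented_rel A \<theta>"
  proof (rule congruentI)
    fix u v assume "(u, v) \<in> presented_rel A \<theta>"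
    then have "F u - F v \<in> null_forms"
      using assms(1)[of u v] assms(2)[of "u - v"] by (simp add: presented_rel_iff)
    then show "presented_rel A \<theta> `` {F u} = presented_rel A \<theta> `` {F v}"
      using cls_eqI unfolding cls_def by blast
  qed
  from UN_equiv_class[OF equiv_presented_rel this, of u] show ?thesis
    using assms(3) by (simp add: cls_def)
qed

lemma act_cls:
  assumes "Poly_Mapping.keys u \<subseteq> formal_triples A"
  shows "f \<in> carrier A \<Longrightarrow> f \<triangleright>\<^bsub>PB\<^esub> cls u = cls (formal_lact f u)"
    and "f \<in> carrier A \<Longrightarrow> cls u \<triangleleft>\<^bsub>PB\<^esub> f = cls (formal_ract f u)"
    and "invol PB (cls u) = cls (formal_invol u)"
  using lift_cls[of "formal_lact f", OF _ _ assms] lift_cls[of "formal_ract f", OF _ _ assms]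
    lift_cls[of formal_invol, OF _ _ assms]
  by (simp_all add: formal_diff formal_lact_null formal_ract_null formal_invol_null)
     (simp_all add: presented_bimodule_def Let_def formal_lact_def formal_ract_def formal_invol_def)

lemma zero_cls: "\<zero>\<^bsub>PB\<^esub> = cls 0"
  by (simp add: presented_bimodule_def Let_def cls_def)

text \<open>Differences of single triples exhaust the formal sums, so an identity between additive
  operations has to be checked on \<open>frag_of (a, x, b)\<close> only.\<close>

lemma additive_cls_eqI:
  assumes "Poly_Mapping.keys u \<subseteq> formal_triples A"
    and "\<And>u v. F (u - v) = F u - F v" and "\<And>u v. G (u - v) = G u - G v"
    and "\<And>a x b. \<lbrakk>a \<in> carrier A; b \<in> carrier A\<rbrakk> \<Longrightarrow> F (frag_of (a, x, b)) - G (frag_of (a, x, b)) \<in> null_forms"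
  shows "cls (F u) = cls (G u)"
proof (rule cls_eqI)
  show "F u - G u \<in> null_forms"
    using assms(1)
  proof (induction rule: frag_induction)
    case zero
    show ?case using assms(2,3)[of 0 0] by (simp add: null_forms_0)
  next
    case (one x)
    then show ?case using assms(4) by (auto simp: formal_triples_def)
  next
    case (diff a b)
    then show ?case
      using null_forms_diff[OF diff] by (simp add: assms(2,3) algebra_simps)
  qed
qed

section \<open>Bimodule axioms and generators of the quotient\<close>

lemma abelian_group_PB: "abelian_group PB"
proof (rule abelian_groupI)
  show "\<exists>Y\<in>carrier PB. Y \<oplus>\<^bsub>PB\<^esub> X = \<zero>\<^bsub>PB\<^esub>" if "X \<in> carrier PB" for X
    using that
  proof (cases rule: carrier_cases)
    case (1 u)
    then show ?thesis
      by (intro bexI[of _ "cls (- u)"]) (simp_all add: add_cls zero_cls cls_carrier)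
  qed
qed (auto elim!: carrier_cases simp: add_cls zero_cls cls_carrier keys_add_subset add.assoc, auto simp: add.commute)

text \<open>On a single triple the axioms for products, units and the involution hold exactly.
  Distributivity in the coefficient holds up to an additivity relator, and the two scalar axioms up
  to a balancing relator.\<close>

theorem star_bimodule_PB: "star_bimodule A PB"
proof -
  interpret M: abelian_group PB by (rule abelian_group_PB)
  note [simp] = add_cls act_cls cls_carrier keys_add_subset formal_carrier smult_closed star_closed
  have eqI: "cls (F u) = cls (G u)"
    if "Poly_Mapping.keys u \<subseteq> formal_triples A"
      "\<And>a x b. \<lbrakk>a \<in> carrier A; b \<in> carrier A\<rbrakk> \<Longrightarrow> F (frag_of (a, x, b)) - G (frag_of (a, x, b)) \<in> null_forms"
      "\<And>u v. F (u - v) = F u - F v" "\<And>u v. G (u - v) = G u - G v" for F G u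
    using additive_cls_eqI[of u F G] that by blast
  show ?thesis
  proof unfold_locales
    fix f \<rho> assume f: "f \<in> carrier A" and \<rho>: "\<rho> \<in> carrier PB"
    obtain u where u: "Poly_Mapping.keys u \<subseteq> formal_triples A" "\<rho> = cls u"
      using \<rho> by (rule carrier_cases)
    show "f \<triangleright>\<^bsub>PB\<^esub> \<rho> \<in> carrier PB" "\<rho> \<triangleleft>\<^bsub>PB\<^esub> f \<in> carrier PB"
      using f u by simp_all
    fix \<sigma> assume \<sigma>: "\<sigma> \<in> carrier PB"
    obtain v where v: "Poly_Mapping.keys v \<subseteq> formal_triples A" "\<sigma> = cls v"
      using \<sigma> by (rule carrier_cases)
    show "f \<triangleright>\<^bsub>PB\<^esub> (\<rho> \<oplus>\<^bsub>PB\<^esub> \<sigma>) = (f \<triangleright>\<^bsub>PB\<^esub> \<rho>) \<oplus>\<^bsub>PB\<^esub> (f \<triangleright>\<^bsub>PB\<^esub> \<sigma>)"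
      "(\<rho> \<oplus>\<^bsub>PB\<^esub> \<sigma>) \<triangleleft>\<^bsub>PB\<^esub> f = (\<rho> \<triangleleft>\<^bsub>PB\<^esub> f) \<oplus>\<^bsub>PB\<^esub> (\<sigma> \<triangleleft>\<^bsub>PB\<^esub> f)"
      using f u v by (simp_all add: formal_diff)
  next
    fix f g \<rho> assume f: "f \<in> carrier A" "g \<in> carrier A" and \<rho>: "\<rho> \<in> carrier PB"
    obtain u where u: "Poly_Mapping.keys u \<subseteq> formal_triples A" "\<rho> = cls u"
      using \<rho> by (rule carrier_cases)
    show "(f \<oplus>\<^bsub>A\<^esub> g) \<triangleright>\<^bsub>PB\<^esub> \<rho> = (f \<triangleright>\<^bsub>PB\<^esub> \<rho>) \<oplus>\<^bsub>PB\<^esub> (g \<triangleright>\<^bsub>PB\<^esub> \<rho>)"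
      using f u eqI[of u "formal_lact (f \<oplus>\<^bsub>A\<^esub> g)" "\<lambda>u. formal_lact f u + formal_lact g u"]
      by (simp add: formal_diff l_distr null_add_left diff_diff_eq[symmetric])
    show "\<rho> \<triangleleft>\<^bsub>PB\<^esub> (f \<oplus>\<^bsub>A\<^esub> g) = (\<rho> \<triangleleft>\<^bsub>PB\<^esub> f) \<oplus>\<^bsub>PB\<^esub> (\<rho> \<triangleleft>\<^bsub>PB\<^esub> g)"
      using f u eqI[of u "formal_ract (f \<oplus>\<^bsub>A\<^esub> g)" "\<lambda>u. formal_ract f u + formal_ract g u"]
      by (simp add: formal_diff r_distr null_add_right diff_diff_eq[symmetric])
    show "(f \<otimes>\<^bsub>A\<^esub> g) \<triangleright>\<^bsub>PB\<^esub> \<rho> = f \<triangleright>\<^bsub>PB\<^esub> (g \<triangleright>\<^bsub>PB\<^esub> \<rho>)"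
      using f u eqI[of u "formal_lact (f \<otimes>\<^bsub>A\<^esub> g)" "\<lambda>u. formal_lact f (formal_lact g u)"]
      by (simp add: formal_diff m_assoc null_forms_0)
    show "\<rho> \<triangleleft>\<^bsub>PB\<^esub> (f \<otimes>\<^bsub>A\<^esub> g) = (\<rho> \<triangleleft>\<^bsub>PB\<^esub> f) \<triangleleft>\<^bsub>PB\<^esub> g"
      using f u eqI[of u "formal_ract (f \<otimes>\<^bsub>A\<^esub> g)" "\<lambda>u. formal_ract g (formal_ract f u)"]
      by (simp add: formal_diff m_assoc null_forms_0)
    show "(f \<triangleright>\<^bsub>PB\<^esub> \<rho>) \<triangleleft>\<^bsub>PB\<^esub> g = f \<triangleright>\<^bsub>PB\<^esub> (\<rho> \<triangleleft>\<^bsub>PB\<^esub> g)"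
      using f u eqI[of u "\<lambda>u. formal_ract g (formal_lact f u)" "\<lambda>u. formal_lact f (formal_ract g u)"]
      by (simp add: formal_diff null_forms_0)
    show "invol PB ((f \<triangleright>\<^bsub>PB\<^esub> \<rho>) \<triangleleft>\<^bsub>PB\<^esub> g) = (star A g \<triangleright>\<^bsub>PB\<^esub> invol PB \<rho>) \<triangleleft>\<^bsub>PB\<^esub> star A f"
      using f u eqI[of u "\<lambda>u. formal_invol (formal_ract g (formal_lact f u))"
          "\<lambda>u. formal_ract (star A f) (formal_lact (star A g) (formal_invol u))"]
      by (simp add: formal_diff star_mult null_forms_0)
  next
    fix \<rho> c assume \<rho>: "\<rho> \<in> carrier PB"
    obtain u where u: "Poly_Mapping.keys u \<subseteq> formal_triples A" "\<rho> = cls u"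
      using \<rho> by (rule carrier_cases)
    show "\<one>\<^bsub>A\<^esub> \<triangleright>\<^bsub>PB\<^esub> \<rho> = \<rho>" "\<rho> \<triangleleft>\<^bsub>PB\<^esub> \<one>\<^bsub>A\<^esub> = \<rho>"
      using u eqI[of u "formal_lact \<one>\<^bsub>A\<^esub>" "\<lambda>u. u"] eqI[of u "formal_ract \<one>\<^bsub>A\<^esub>" "\<lambda>u. u"]
      by (simp_all add: formal_diff null_forms_0)
    show "invol PB \<rho> \<in> carrier PB" using u by simp
    show "invol PB (invol PB \<rho>) = \<rho>"
      using u eqI[of u "\<lambda>u. formal_invol (formal_invol u)" "\<lambda>u. u"]
      by (simp add: formal_diff null_forms_0 star_star s_s)
    show "(c \<odot>\<^bsub>A\<^esub> \<one>\<^bsub>A\<^esub>) \<triangleright>\<^bsub>PB\<^esub> \<rho> = \<rho> \<triangleleft>\<^bsub>PB\<^esub> (c \<odot>\<^bsub>A\<^esub> \<one>\<^bsub>A\<^esub>)"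
      using u eqI[of u "formal_lact (c \<odot>\<^bsub>A\<^esub> \<one>\<^bsub>A\<^esub>)" "formal_ract (c \<odot>\<^bsub>A\<^esub> \<one>\<^bsub>A\<^esub>)"]
      by (simp add: formal_diff smult_mult_left smult_mult_right null_balance)
    show "invol PB ((c \<odot>\<^bsub>A\<^esub> \<one>\<^bsub>A\<^esub>) \<triangleright>\<^bsub>PB\<^esub> \<rho>) = (cnj c \<odot>\<^bsub>A\<^esub> \<one>\<^bsub>A\<^esub>) \<triangleright>\<^bsub>PB\<^esub> invol PB \<rho>"
      using u eqI[of u "\<lambda>u. formal_invol (formal_lact (c \<odot>\<^bsub>A\<^esub> \<one>\<^bsub>A\<^esub>) u)" "\<lambda>u. formal_lact (cnj c \<odot>\<^bsub>A\<^esub> \<one>\<^bsub>A\<^esub>) (formal_invol u)"]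
        null_forms_commute[OF null_balance[of "star A b" "star A a" "cnj c" for a b]]
      by (simp add: formal_diff star_smult star_one smult_mult_left)
    fix \<sigma> assume \<sigma>: "\<sigma> \<in> carrier PB"
    obtain v where v: "Poly_Mapping.keys v \<subseteq> formal_triples A" "\<sigma> = cls v"
      using \<sigma> by (rule carrier_cases)
    show "invol PB (\<rho> \<oplus>\<^bsub>PB\<^esub> \<sigma>) = invol PB \<rho> \<oplus>\<^bsub>PB\<^esub> invol PB \<sigma>"
      using u v by (simp add: formal_diff)
  qed
qed

lemma presented_generator_eq: "presented_generator A \<theta> x = cls (frag_of (\<one>\<^bsub>A\<^esub>, x, \<one>\<^bsub>A\<^esub>))"
  by (simp add: presented_generator_def cls_def)

lemma generator_carrier: "presented_generator A \<theta> x \<in> carrier PB"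
  by (simp add: presented_generator_eq cls_carrier formal_triples_def)

text \<open>This is the twist relator with both outer coefficients equal to the unit.\<close>

lemma generator_twist:
  assumes "f \<in> carrier A" "\<theta> x f \<in> carrier A"
  shows "presented_generator A \<theta> x \<triangleleft>\<^bsub>PB\<^esub> f = \<theta> x f \<triangleright>\<^bsub>PB\<^esub> presented_generator A \<theta> x"
  using assms cls_eqI[OF null_twist[of "\<one>\<^bsub>A\<^esub>" "\<one>\<^bsub>A\<^esub>" f x]]
  by (simp add: presented_generator_eq act_cls formal_triples_def)

lemma invol_generator: "invol PB (presented_generator A \<theta> x) = presented_generator A \<theta> (s x)"
  by (simp add: presented_generator_eq act_cls formal_triples_def star_one)

end

section \<open>Inner derivations with twisted coordinate differentials\<close>

context star_bimodule
begin

section \<open>Zero, negatives and adjoints in a star bimodule\<close>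

lemma lact_zero: "\<rho> \<in> carrier M \<Longrightarrow> \<zero>\<^bsub>A\<^esub> \<triangleright>\<^bsub>M\<^esub> \<rho> = \<zero>\<^bsub>M\<^esub>"
  using lact_add_left[of "\<zero>\<^bsub>A\<^esub>" "\<zero>\<^bsub>A\<^esub>" \<rho>] lact_closed[of "\<zero>\<^bsub>A\<^esub>" \<rho>] M.add.r_cancel_one by simp

lemma lact_zero_right: "f \<in> carrier A \<Longrightarrow> f \<triangleright>\<^bsub>M\<^esub> \<zero>\<^bsub>M\<^esub> = \<zero>\<^bsub>M\<^esub>"
  using lact_add_right[of f "\<zero>\<^bsub>M\<^esub>" "\<zero>\<^bsub>M\<^esub>"] lact_closed[of f "\<zero>\<^bsub>M\<^esub>"] M.add.r_cancel_one by simp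

lemma ract_zero: "f \<in> carrier A \<Longrightarrow> \<zero>\<^bsub>M\<^esub> \<triangleleft>\<^bsub>M\<^esub> f = \<zero>\<^bsub>M\<^esub>"
  using ract_add_left[of f "\<zero>\<^bsub>M\<^esub>" "\<zero>\<^bsub>M\<^esub>"] ract_closed[of f "\<zero>\<^bsub>M\<^esub>"] M.add.r_cancel_one by simp

lemma lact_minus:
  assumes "f \<in> carrier A" "\<rho> \<in> carrier M"
  shows "f \<triangleright>\<^bsub>M\<^esub> (\<ominus>\<^bsub>M\<^esub> \<rho>) = \<ominus>\<^bsub>M\<^esub> (f \<triangleright>\<^bsub>M\<^esub> \<rho>)"
proof (rule M.minus_equality[symmetric])
  show "(f \<triangleright>\<^bsub>M\<^esub> (\<ominus>\<^bsub>M\<^esub> \<rho>)) \<oplus>\<^bsub>M\<^esub> (f \<triangleright>\<^bsub>M\<^esub> \<rho>) = \<zero>\<^bsub>M\<^esub>"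
    using assms by (simp add: lact_add_right[symmetric] M.l_neg lact_zero_right)
qed (use assms in \<open>simp_all add: lact_closed\<close>)

lemma minus_lact:
  assumes "f \<in> carrier A" "\<rho> \<in> carrier M"
  shows "(\<ominus>\<^bsub>A\<^esub> f) \<triangleright>\<^bsub>M\<^esub> \<rho> = \<ominus>\<^bsub>M\<^esub> (f \<triangleright>\<^bsub>M\<^esub> \<rho>)"
proof (rule M.minus_equality[symmetric])
  show "((\<ominus>\<^bsub>A\<^esub> f) \<triangleright>\<^bsub>M\<^esub> \<rho>) \<oplus>\<^bsub>M\<^esub> (f \<triangleright>\<^bsub>M\<^esub> \<rho>) = \<zero>\<^bsub>M\<^esub>"
    using assms by (simp add: lact_add_left[symmetric] A.l_neg lact_zero)
qed (use assms in \<open>simp_all add: lact_closed\<close>)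

lemma ract_minus:
  assumes "f \<in> carrier A" "\<rho> \<in> carrier M"
  shows "(\<ominus>\<^bsub>M\<^esub> \<rho>) \<triangleleft>\<^bsub>M\<^esub> f = \<ominus>\<^bsub>M\<^esub> (\<rho> \<triangleleft>\<^bsub>M\<^esub> f)"
proof (rule M.minus_equality[symmetric])
  show "((\<ominus>\<^bsub>M\<^esub> \<rho>) \<triangleleft>\<^bsub>M\<^esub> f) \<oplus>\<^bsub>M\<^esub> (\<rho> \<triangleleft>\<^bsub>M\<^esub> f) = \<zero>\<^bsub>M\<^esub>"
    using assms by (simp add: ract_add_left[symmetric] M.l_neg ract_zero)
qed (use assms in \<open>simp_all add: ract_closed\<close>)

lemma invol_minus:
  assumes "\<rho> \<in> carrier M"
  shows "invol M (\<ominus>\<^bsub>M\<^esub> \<rho>) = \<ominus>\<^bsub>M\<^esub> invol M \<rho>"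
proof (rule M.minus_equality[symmetric])
  have "invol M \<zero>\<^bsub>M\<^esub> = \<zero>\<^bsub>M\<^esub>"
    using invol_add[of "\<zero>\<^bsub>M\<^esub>" "\<zero>\<^bsub>M\<^esub>"] invol_closed[of "\<zero>\<^bsub>M\<^esub>"] M.add.r_cancel_one by simp
  then show "invol M (\<ominus>\<^bsub>M\<^esub> \<rho>) \<oplus>\<^bsub>M\<^esub> invol M \<rho> = \<zero>\<^bsub>M\<^esub>"
    using assms by (simp add: invol_add[symmetric] M.l_neg)
qed (use assms in \<open>simp_all add: invol_closed\<close>)

lemma invol_lact:
  "\<lbrakk>f \<in> carrier A; \<rho> \<in> carrier M\<rbrakk> \<Longrightarrow> invol M (f \<triangleright>\<^bsub>M\<^esub> \<rho>) = invol M \<rho> \<triangleleft>\<^bsub>M\<^esub> star A f"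
  using invol_act[of f "\<one>\<^bsub>A\<^esub>" \<rho>] by (simp add: A.star_one ract_one lact_one lact_closed invol_closed)

lemma invol_ract:
  "\<lbrakk>f \<in> carrier A; \<rho> \<in> carrier M\<rbrakk> \<Longrightarrow> invol M (\<rho> \<triangleleft>\<^bsub>M\<^esub> f) = star A f \<triangleright>\<^bsub>M\<^esub> invol M \<rho>"
  using invol_act[of "\<one>\<^bsub>A\<^esub>" f \<rho>]
  by (simp add: A.star_one ract_one lact_one lact_closed invol_closed A.star_closed)

lemma star_bimodule_restrict:
  assumes C: "C \<subseteq> carrier A" "complex_star_algebra (A\<lparr>carrier := C\<rparr>)"
    and S: "S \<subseteq> carrier M" "\<zero>\<^bsub>M\<^esub> \<in> S"
      "\<And>\<rho> \<sigma>. \<rho> \<in> S \<Longrightarrow> \<sigma> \<in> S \<Longrightarrow> \<rho> \<oplus>\<^bsub>M\<^esub> \<sigma> \<in> S" "\<And>\<rho>. \<rho> \<in> S \<Longrightarrow> \<ominus>\<^bsub>M\<^esub> \<rho> \<in> S"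
      "\<And>f \<rho>. f \<in> C \<Longrightarrow> \<rho> \<in> S \<Longrightarrow> f \<triangleright>\<^bsub>M\<^esub> \<rho> \<in> S" "\<And>f \<rho>. f \<in> C \<Longrightarrow> \<rho> \<in> S \<Longrightarrow> \<rho> \<triangleleft>\<^bsub>M\<^esub> f \<in> S"
      "\<And>\<rho>. \<rho> \<in> S \<Longrightarrow> invol M \<rho> \<in> S"
  shows "star_bimodule (A\<lparr>carrier := C\<rparr>) (M\<lparr>carrier := S\<rparr>)"
proof -
  interpret C: complex_star_algebra "A\<lparr>carrier := C\<rparr>" by fact
  interpret S: abelian_group "M\<lparr>carrier := S\<rparr>"
  proof (rule abelian_groupI)
    fix \<rho> assume "\<rho> \<in> carrier (M\<lparr>carrier := S\<rparr>)"
    then show "\<exists>\<sigma>\<in>carrier (M\<lparr>carrier := S\<rparr>). \<sigma> \<oplus>\<^bsub>M\<lparr>carrier := S\<rparr>\<^esub> \<rho> = \<zero>\<^bsub>M\<lparr>carrier := S\<rparr>\<^esub>"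
      using S(1,4) by (intro bexI[of _ "\<ominus>\<^bsub>M\<^esub> \<rho>"]) (auto simp: M.l_neg)
  qed (use S in \<open>auto simp: M.a_ac subset_eq\<close>)
  have sub: "f \<in> C \<Longrightarrow> f \<in> carrier A" "\<rho> \<in> S \<Longrightarrow> \<rho> \<in> carrier M" for f \<rho>
    using C(1) S(1) by auto
  show ?thesis
    by unfold_locales
      (auto simp: sub S intro: lact_add_left lact_add_right ract_add_left ract_add_right lact_mult ract_mult
        lact_one ract_one lact_ract scalar_central invol_invol invol_add invol_scalar invol_act)
qed

end

text \<open>The bimodule lives over the large algebra \<open>A\<close>, while coefficients are
  confined to the subalgebra \<open>C\<close>. Stability of \<open>C\<close> under
  \<open>\<tau>\<close> and \<open>\<tau>'\<close> is what permits moving coefficients across the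
  coordinate differentials without leaving \<open>C\<close>; skewness of \<open>\<zeta>\<close>
  makes the commutator compatible with the star.\<close>

locale inner_coordinate_calculus = star_bimodule A M
  for A :: "('a, 'x) star_algebra_scheme" and M :: "('a, 'm, 'y) star_bimodule_scheme" +
  fixes \<zeta> :: 'm and C :: "'a set" and z :: 'a and \<tau> \<tau>' :: "'a \<Rightarrow> 'a" and d :: "'a \<Rightarrow> 'm"
  defines "d \<equiv> \<lambda>f. (\<zeta> \<triangleleft>\<^bsub>M\<^esub> f) \<ominus>\<^bsub>M\<^esub> (f \<triangleright>\<^bsub>M\<^esub> \<zeta>)"
  assumes \<zeta>_closed: "\<zeta> \<in> carrier M" and invol_\<zeta>: "invol M \<zeta> = \<ominus>\<^bsub>M\<^esub> \<zeta>"
    and C_sub: "C \<subseteq> carrier A" and C_algebra: "complex_star_algebra (A\<lparr>carrier := C\<rparr>)"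
    and z_C: "z \<in> C"
    and \<tau>_C: "f \<in> C \<Longrightarrow> \<tau> f \<in> C" and \<tau>'_C: "f \<in> C \<Longrightarrow> \<tau>' f \<in> C"
    and dz_ract: "f \<in> C \<Longrightarrow> d z \<triangleleft>\<^bsub>M\<^esub> f = \<tau> f \<triangleright>\<^bsub>M\<^esub> d z"
    and dz'_ract: "f \<in> C \<Longrightarrow> d (star A z) \<triangleleft>\<^bsub>M\<^esub> f = \<tau>' f \<triangleright>\<^bsub>M\<^esub> d (star A z)"
    and d_coordinates: "f \<in> C \<Longrightarrow>
      \<exists>g\<in>C. \<exists>h\<in>C. d f = (g \<triangleright>\<^bsub>M\<^esub> d z) \<oplus>\<^bsub>M\<^esub> (h \<triangleright>\<^bsub>M\<^esub> d (star A z))"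
begin

sublocale C: complex_star_algebra "A\<lparr>carrier := C\<rparr>"
  by (rule C_algebra)

lemma C_simps [simp]:
  "f \<in> C \<Longrightarrow> f \<in> carrier A" "\<zero>\<^bsub>A\<^esub> \<in> C" "\<one>\<^bsub>A\<^esub> \<in> C"
  "f \<in> C \<Longrightarrow> g \<in> C \<Longrightarrow> f \<oplus>\<^bsub>A\<^esub> g \<in> C" "f \<in> C \<Longrightarrow> g \<in> C \<Longrightarrow> f \<otimes>\<^bsub>A\<^esub> g \<in> C"
  "f \<in> C \<Longrightarrow> star A f \<in> C" "f \<in> C \<Longrightarrow> c \<odot>\<^bsub>A\<^esub> f \<in> C"
  using C_sub C.zero_closed C.one_closed C.a_closed C.m_closed C.star_closed C.smult_closed by auto

text \<open>Additive inverses are chosen inside a carrier, so the inverse of the subalgebra has to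
  be identified with that of \<open>A\<close>, by uniqueness in \<open>A\<close>.\<close>

lemma C_minus [simp]: "f \<in> C \<Longrightarrow> \<ominus>\<^bsub>A\<^esub> f \<in> C"
  using C.add.inv_closed[of f] C.l_neg[of f] A.minus_equality[of "\<ominus>\<^bsub>A\<lparr>carrier := C\<rparr>\<^esub> f" f] by auto

lemmas [simp] = \<zeta>_closed lact_closed ract_closed invol_closed \<tau>_C \<tau>'_C z_C A.star_closed A.smult_closed

lemma d_in_carrier [simp]: "f \<in> carrier A \<Longrightarrow> d f \<in> carrier M"
  by (simp add: d_def)

definition "forms = {(\<alpha> \<triangleright>\<^bsub>M\<^esub> d z) \<triangleleft>\<^bsub>M\<^esub> \<alpha>' \<oplus>\<^bsub>M\<^esub> (\<beta> \<triangleright>\<^bsub>M\<^esub> d (star A z)) \<triangleleft>\<^bsub>M\<^esub> \<beta>' | \<alpha> \<alpha>' \<beta> \<beta>'.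
  \<alpha> \<in> C \<and> \<alpha>' \<in> C \<and> \<beta> \<in> C \<and> \<beta>' \<in> C}"

lemma lact_ract_dz:
  "\<lbrakk>f \<in> C; g \<in> C\<rbrakk> \<Longrightarrow> (f \<triangleright>\<^bsub>M\<^esub> d z) \<triangleleft>\<^bsub>M\<^esub> g = (f \<otimes>\<^bsub>A\<^esub> \<tau> g) \<triangleright>\<^bsub>M\<^esub> d z"
  "\<lbrakk>f \<in> C; g \<in> C\<rbrakk> \<Longrightarrow> (f \<triangleright>\<^bsub>M\<^esub> d (star A z)) \<triangleleft>\<^bsub>M\<^esub> g = (f \<otimes>\<^bsub>A\<^esub> \<tau>' g) \<triangleright>\<^bsub>M\<^esub> d (star A z)"
  by (simp_all add: lact_ract dz_ract dz'_ract lact_mult)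

text \<open>A sum of two products with coefficients on both sides is not visibly such a product
  again, whereas left coefficients simply add. Unit right coefficients give the converse
  inclusion.\<close>

lemma forms_eq: "forms = {(f \<triangleright>\<^bsub>M\<^esub> d z) \<oplus>\<^bsub>M\<^esub> (g \<triangleright>\<^bsub>M\<^esub> d (star A z)) | f g. f \<in> C \<and> g \<in> C}"
proof (intro equalityI subsetI)
  fix \<rho> assume "\<rho> \<in> forms"
  then obtain \<alpha> \<alpha>' \<beta> \<beta>' where "\<alpha> \<in> C" "\<alpha>' \<in> C" "\<beta> \<in> C" "\<beta>' \<in> C"
    "\<rho> = (\<alpha> \<triangleright>\<^bsub>M\<^esub> d z) \<triangleleft>\<^bsub>M\<^esub> \<alpha>' \<oplus>\<^bsub>M\<^esub> (\<beta> \<triangleright>\<^bsub>M\<^esub> d (star A z)) \<triangleleft>\<^bsub>M\<^esub> \<beta>'"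
    unfolding forms_def by blast
  then show "\<rho> \<in> {(f \<triangleright>\<^bsub>M\<^esub> d z) \<oplus>\<^bsub>M\<^esub> (g \<triangleright>\<^bsub>M\<^esub> d (star A z)) | f g. f \<in> C \<and> g \<in> C}"
    by (intro CollectI exI[of _ "\<alpha> \<otimes>\<^bsub>A\<^esub> \<tau> \<alpha>'"] exI[of _ "\<beta> \<otimes>\<^bsub>A\<^esub> \<tau>' \<beta>'"]) (simp add: lact_ract_dz)
next
  fix \<rho> assume "\<rho> \<in> {(f \<triangleright>\<^bsub>M\<^esub> d z) \<oplus>\<^bsub>M\<^esub> (g \<triangleright>\<^bsub>M\<^esub> d (star A z)) | f g. f \<in> C \<and> g \<in> C}"
  then obtain f g where "f \<in> C" "g \<in> C" "\<rho> = (f \<triangleright>\<^bsub>M\<^esub> d z) \<oplus>\<^bsub>M\<^esub> (g \<triangleright>\<^bsub>M\<^esub> d (star A z))" by blast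
  then show "\<rho> \<in> forms"
    unfolding forms_def
    by (intro CollectI exI[of _ f] exI[of _ "\<one>\<^bsub>A\<^esub>"] exI[of _ g]) (simp add: ract_one)
qed

lemma forms_cases:
  assumes "\<rho> \<in> forms"
  obtains f g where "f \<in> C" "g \<in> C" "\<rho> = (f \<triangleright>\<^bsub>M\<^esub> d z) \<oplus>\<^bsub>M\<^esub> (g \<triangleright>\<^bsub>M\<^esub> d (star A z))"
  using assms unfolding forms_eq by blast

lemma formsI: "\<lbrakk>f \<in> C; g \<in> C\<rbrakk> \<Longrightarrow> (f \<triangleright>\<^bsub>M\<^esub> d z) \<oplus>\<^bsub>M\<^esub> (g \<triangleright>\<^bsub>M\<^esub> d (star A z)) \<in> forms"
  unfolding forms_eq by blast

lemma d_forms: "f \<in> C \<Longrightarrow> d f \<in> forms"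
  using d_coordinates[of f] formsI by auto

text \<open>For skew \<open>\<zeta>\<close>, the adjoint of the commutator
  [\<open>\<zeta>\<close>, f] is [f*, \<open>\<zeta>\<close>*] =
  [\<open>\<zeta>\<close>, f*].\<close>

lemma d_adjoint: 
  assumes "f \<in> carrier A" shows "d (star A f) = invol M (d f)"
  using assms
  by (simp add: d_def a_minus_def invol_add invol_minus invol_lact invol_ract invol_\<zeta> lact_minus
      ract_minus M.a_comm)

lemma forms_add: "\<lbrakk>\<rho> \<in> forms; \<sigma> \<in> forms\<rbrakk> \<Longrightarrow> \<rho> \<oplus>\<^bsub>M\<^esub> \<sigma> \<in> forms"
proof (elim forms_cases)
  fix f g f' g' assume *: "f \<in> C" "g \<in> C" "f' \<in> C" "g' \<in> C"
    and \<rho>: "\<rho> = (f \<triangleright>\<^bsub>M\<^esub> d z) \<oplus>\<^bsub>M\<^esub> (g \<triangleright>\<^bsub>M\<^esub> d (star A z))"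
    and \<sigma>: "\<sigma> = (f' \<triangleright>\<^bsub>M\<^esub> d z) \<oplus>\<^bsub>M\<^esub> (g' \<triangleright>\<^bsub>M\<^esub> d (star A z))"
  have "\<rho> \<oplus>\<^bsub>M\<^esub> \<sigma> = ((f \<oplus>\<^bsub>A\<^esub> f') \<triangleright>\<^bsub>M\<^esub> d z) \<oplus>\<^bsub>M\<^esub> ((g \<oplus>\<^bsub>A\<^esub> g') \<triangleright>\<^bsub>M\<^esub> d (star A z))"
    using * by (simp add: \<rho> \<sigma> lact_add_left M.a_ac)
  then show ?thesis using * formsI by simp
qed

lemma forms_lact: "\<lbrakk>h \<in> C; \<rho> \<in> forms\<rbrakk> \<Longrightarrow> h \<triangleright>\<^bsub>M\<^esub> \<rho> \<in> forms"
proof (elim forms_cases)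
  fix f g assume *: "h \<in> C" "f \<in> C" "g \<in> C"
    and \<rho>: "\<rho> = (f \<triangleright>\<^bsub>M\<^esub> d z) \<oplus>\<^bsub>M\<^esub> (g \<triangleright>\<^bsub>M\<^esub> d (star A z))"
  have "h \<triangleright>\<^bsub>M\<^esub> \<rho> = ((h \<otimes>\<^bsub>A\<^esub> f) \<triangleright>\<^bsub>M\<^esub> d z) \<oplus>\<^bsub>M\<^esub> ((h \<otimes>\<^bsub>A\<^esub> g) \<triangleright>\<^bsub>M\<^esub> d (star A z))"
    using * by (simp add: \<rho> lact_add_right lact_mult)
  then show ?thesis using * formsI by simp
qed

lemma forms_ract: "\<lbrakk>h \<in> C; \<rho> \<in> forms\<rbrakk> \<Longrightarrow> \<rho> \<triangleleft>\<^bsub>M\<^esub> h \<in> forms"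
proof (elim forms_cases)
  fix f g assume *: "h \<in> C" "f \<in> C" "g \<in> C"
    and \<rho>: "\<rho> = (f \<triangleright>\<^bsub>M\<^esub> d z) \<oplus>\<^bsub>M\<^esub> (g \<triangleright>\<^bsub>M\<^esub> d (star A z))"
  have "\<rho> \<triangleleft>\<^bsub>M\<^esub> h = ((f \<otimes>\<^bsub>A\<^esub> \<tau> h) \<triangleright>\<^bsub>M\<^esub> d z) \<oplus>\<^bsub>M\<^esub> ((g \<otimes>\<^bsub>A\<^esub> \<tau>' h) \<triangleright>\<^bsub>M\<^esub> d (star A z))"
    using * by (simp add: \<rho> ract_add_left lact_ract_dz)
  then show ?thesis using * formsI by simp
qed

lemma forms_invol: "\<rho> \<in> forms \<Longrightarrow> invol M \<rho> \<in> forms"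
proof (elim forms_cases)
  fix f g assume *: "f \<in> C" "g \<in> C"
    and \<rho>: "\<rho> = (f \<triangleright>\<^bsub>M\<^esub> d z) \<oplus>\<^bsub>M\<^esub> (g \<triangleright>\<^bsub>M\<^esub> d (star A z))"
  have "invol M \<rho> = (\<tau> (star A g) \<triangleright>\<^bsub>M\<^esub> d z) \<oplus>\<^bsub>M\<^esub> (\<tau>' (star A f) \<triangleright>\<^bsub>M\<^esub> d (star A z))"
    using * by (simp add: \<rho> invol_add invol_lact d_adjoint[symmetric] A.star_star dz_ract dz'_ract M.a_comm)
  then show ?thesis using * formsI by simp
qed

lemma forms_minus: "\<rho> \<in> forms \<Longrightarrow> \<ominus>\<^bsub>M\<^esub> \<rho> \<in> forms"
proof (elim forms_cases)
  fix f g assume *: "f \<in> C" "g \<in> C"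
    and \<rho>: "\<rho> = (f \<triangleright>\<^bsub>M\<^esub> d z) \<oplus>\<^bsub>M\<^esub> (g \<triangleright>\<^bsub>M\<^esub> d (star A z))"
  have "\<ominus>\<^bsub>M\<^esub> \<rho> = ((\<ominus>\<^bsub>A\<^esub> f) \<triangleright>\<^bsub>M\<^esub> d z) \<oplus>\<^bsub>M\<^esub> ((\<ominus>\<^bsub>A\<^esub> g) \<triangleright>\<^bsub>M\<^esub> d (star A z))"
    using * by (simp add: \<rho> minus_lact M.minus_add)
  then show ?thesis using * formsI by simp
qed

theorem first_order_star_calculus_forms:
  "first_order_star_calculus (A\<lparr>carrier := C\<rparr>) (M\<lparr>carrier := forms\<rparr>) d"
proof -
  have sub: "forms \<subseteq> carrier M"
    by (auto elim!: forms_cases)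
  have "\<zero>\<^bsub>M\<^esub> \<in> forms"
    using formsI[of "\<zero>\<^bsub>A\<^esub>" "\<zero>\<^bsub>A\<^esub>"] by (simp add: lact_zero)
  then interpret S: star_bimodule "A\<lparr>carrier := C\<rparr>" "M\<lparr>carrier := forms\<rparr>"
    using C_sub C_algebra sub forms_add forms_minus forms_lact forms_ract forms_invol
    by (intro star_bimodule_restrict) auto
  show ?thesis
  proof unfold_locales
    fix f assume f: "f \<in> carrier (A\<lparr>carrier := C\<rparr>)"
    then show "d f \<in> carrier (M\<lparr>carrier := forms\<rparr>)" by (simp add: d_forms)
    show "d (star (A\<lparr>carrier := C\<rparr>) f) = invol (M\<lparr>carrier := forms\<rparr>) (d f)"
      using f by (simp add: d_adjoint)
    fix c
    have "d (c \<odot>\<^bsub>A\<^esub> f) = (c \<odot>\<^bsub>A\<^esub> \<one>\<^bsub>A\<^esub>) \<triangleright>\<^bsub>M\<^esub> d f"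
    proof -
      have eq: "c \<odot>\<^bsub>A\<^esub> f = (c \<odot>\<^bsub>A\<^esub> \<one>\<^bsub>A\<^esub>) \<otimes>\<^bsub>A\<^esub> f"
        using f by (simp add: A.smult_mult_left)
      \<comment> \<open>The scalar crosses \<open>\<zeta>\<close> because a multiple of the unit
        acts in the same way from both sides.\<close>
      have "\<zeta> \<triangleleft>\<^bsub>M\<^esub> (c \<odot>\<^bsub>A\<^esub> f) = (c \<odot>\<^bsub>A\<^esub> \<one>\<^bsub>A\<^esub>) \<triangleright>\<^bsub>M\<^esub> (\<zeta> \<triangleleft>\<^bsub>M\<^esub> f)"
        using f by (simp add: eq ract_mult scalar_central[symmetric] lact_ract)
      moreover have "(c \<odot>\<^bsub>A\<^esub> f) \<triangleright>\<^bsub>M\<^esub> \<zeta> = (c \<odot>\<^bsub>A\<^esub> \<one>\<^bsub>A\<^esub>) \<triangleright>\<^bsub>M\<^esub> (f \<triangleright>\<^bsub>M\<^esub> \<zeta>)"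
        using f by (simp add: eq lact_mult)
      ultimately show ?thesis
        using f by (simp add: d_def a_minus_def lact_add_right lact_minus)
    qed
    then show "d (c \<odot>\<^bsub>A\<lparr>carrier := C\<rparr>\<^esub> f) =
        (c \<odot>\<^bsub>A\<lparr>carrier := C\<rparr>\<^esub> \<one>\<^bsub>A\<lparr>carrier := C\<rparr>\<^esub>) \<triangleright>\<^bsub>M\<lparr>carrier := forms\<rparr>\<^esub> d f"
      by simp
    fix g assume g: "g \<in> carrier (A\<lparr>carrier := C\<rparr>)"
    have "d (f \<oplus>\<^bsub>A\<^esub> g) = d f \<oplus>\<^bsub>M\<^esub> d g"
      using f g by (simp add: d_def a_minus_def lact_add_left ract_add_right M.minus_add M.a_ac)
    then show "d (f \<oplus>\<^bsub>A\<lparr>carrier := C\<rparr>\<^esub> g) = d f \<oplus>\<^bsub>M\<lparr>carrier := forms\<rparr>\<^esub> d g" by simp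
    \<comment> \<open>In ([\<open>\<zeta>\<close>, f]) g + f [\<open>\<zeta>\<close>, g] the middle
      terms - f \<open>\<zeta>\<close> g and + f \<open>\<zeta>\<close> g cancel; b stands for this
      term.\<close>
    have cancel: "a \<oplus>\<^bsub>M\<^esub> (\<ominus>\<^bsub>M\<^esub> b \<oplus>\<^bsub>M\<^esub> (b \<oplus>\<^bsub>M\<^esub> c)) = a \<oplus>\<^bsub>M\<^esub> c"
      if "a \<in> carrier M" "b \<in> carrier M" "c \<in> carrier M" for a b c
      using that by (simp add: M.r_neg1)
    have "d (f \<otimes>\<^bsub>A\<^esub> g) = (d f \<triangleleft>\<^bsub>M\<^esub> g) \<oplus>\<^bsub>M\<^esub> (f \<triangleright>\<^bsub>M\<^esub> d g)"
      using f g by (simp add: d_def a_minus_def ract_add_left lact_add_right ract_mult lact_mult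
          lact_minus ract_minus lact_ract M.a_assoc cancel)
    then show "d (f \<otimes>\<^bsub>A\<lparr>carrier := C\<rparr>\<^esub> g) =
        (d f \<triangleleft>\<^bsub>M\<lparr>carrier := forms\<rparr>\<^esub> g) \<oplus>\<^bsub>M\<lparr>carrier := forms\<rparr>\<^esub> (f \<triangleright>\<^bsub>M\<lparr>carrier := forms\<rparr>\<^esub> d g)"
      by simp
  next
    fix \<rho> assume \<rho>: "\<rho> \<in> carrier (M\<lparr>carrier := forms\<rparr>)"
    then obtain f g where fg: "f \<in> C" "g \<in> C"
      and eq: "\<rho> = (f \<triangleright>\<^bsub>M\<^esub> d z) \<oplus>\<^bsub>M\<^esub> (g \<triangleright>\<^bsub>M\<^esub> d (star A z))"
      by (auto elim: forms_cases)
    let ?F = "\<lambda>i::nat. if i = 0 then f else g" and ?G = "\<lambda>i::nat. if i = 0 then z else star A z"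
    have "{..<2::nat} = {0, 1}" by auto
    then have "\<rho> = (\<Oplus>\<^bsub>M\<lparr>carrier := forms\<rparr>\<^esub>i\<in>{..<2}. ?F i \<triangleright>\<^bsub>M\<lparr>carrier := forms\<rparr>\<^esub> d (?G i))"
      using fg by (simp add: eq d_forms forms_lact forms_add Pi_iff)
    then show "\<exists>(n::nat) f g. f \<in> {..<n} \<rightarrow> carrier (A\<lparr>carrier := C\<rparr>) \<and>
        g \<in> {..<n} \<rightarrow> carrier (A\<lparr>carrier := C\<rparr>) \<and>
        \<rho> = (\<Oplus>\<^bsub>M\<lparr>carrier := forms\<rparr>\<^esub>i\<in>{..<n}. f i \<triangleright>\<^bsub>M\<lparr>carrier := forms\<rparr>\<^esub> d (g i))"
      using fg by (intro exI[of _ 2] exI[of _ ?F] exI[of _ ?G]) simp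
  qed
qed

end

section \<open>Twists and difference quotients of functions on \<open>Gam_bar q\<close>\<close>

text \<open>The value at \<open>0\<close> is unconstrained in \<open>circ_hol\<close>, because the \<open>q\<close>-derivatives have a junk value
  there. In the notation of the paper, \<open>twist q e k f z\<close> is \<open>f(q\<^sup>e\<cdot>q\<^sup>kz)\<close>.\<close>

definition circ_hol :: "real \<Rightarrow> (complex \<Rightarrow> complex) \<Rightarrow> bool" where
  "circ_hol q f \<longleftrightarrow> (\<forall>z. z \<notin> Gam_bar q \<longrightarrow> f z = 0) \<and>
     (\<forall>n::int. \<exists>h. h holomorphic_on (- {0}) \<and> (\<forall>z. norm z = q powi n \<longrightarrow> h z = f z))"

definition twist :: "real \<Rightarrow> int \<Rightarrow> int \<Rightarrow> (complex \<Rightarrow> complex) \<Rightarrow> complex \<Rightarrow> complex" where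
  "twist q e k f z = orbit_extension q f (of_real (q powi k) * z) (- \<i> * of_int e)"

definition diff_quot ::
    "real \<Rightarrow> int \<Rightarrow> int \<Rightarrow> complex \<Rightarrow> (complex \<Rightarrow> complex) \<Rightarrow> (complex \<Rightarrow> complex) \<Rightarrow> complex \<Rightarrow> complex" where
  "diff_quot q e k c w f = (\<lambda>z. (f z - twist q e k f z) / (c * w z))"

definition q_derivs :: "real \<Rightarrow> ((complex \<Rightarrow> complex) \<Rightarrow> complex \<Rightarrow> complex) set" where
  "q_derivs q = {dR_z q, dL_z q, dL_zbar q, dR_zbar q}"

text \<open>Smoothness speaks of words of derivatives of every length. Grading by length gives an
  induction in which the derivative of a product at one level needs products only at the level
  below.\<close>

primrec smooth_upto :: "real \<Rightarrow> nat \<Rightarrow> (complex \<Rightarrow> complex) \<Rightarrow> bool" where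
  "smooth_upto q 0 f \<longleftrightarrow> circ_hol q f \<and> (\<exists>L. (f \<longlongrightarrow> L) (at 0 within Gam q))"
| "smooth_upto q (Suc n) f \<longleftrightarrow> circ_hol q f \<and> (\<exists>L. (f \<longlongrightarrow> L) (at 0 within Gam q)) \<and>
     (\<forall>D \<in> q_derivs q. smooth_upto q n (D f))"

text \<open>Scalars as elements of the function algebra, so that closure under scaling becomes a
  case of closure under products.\<close>

definition const_fun :: "real \<Rightarrow> complex \<Rightarrow> complex \<Rightarrow> complex" where
  "const_fun q c = (\<lambda>z. if z \<in> Gam_bar q then c else 0)"

lemma complex_star_algebra_fun:
  assumes "const_fun q 1 \<in> S" and "\<And>f g. f \<in> S \<Longrightarrow> g \<in> S \<Longrightarrow> (\<lambda>z. f z + g z) \<in> S"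
    and "\<And>f g. f \<in> S \<Longrightarrow> g \<in> S \<Longrightarrow> (\<lambda>z. f z * g z) \<in> S"
    and scale: "\<And>c f. f \<in> S \<Longrightarrow> (\<lambda>z. c * f z) \<in> S" and "\<And>f. f \<in> S \<Longrightarrow> (\<lambda>z. cnj (f z)) \<in> S"
    and outside: "\<And>f z. f \<in> S \<Longrightarrow> z \<notin> Gam_bar q \<Longrightarrow> f z = 0"
  shows "complex_star_algebra (fun_star_algebra q S)"
proof -
  have zero: "(\<lambda>z. 0) \<in> S"
    using scale[OF assms(1), of 0] by simp
  have one: "(\<lambda>z. if z \<in> Gam_bar q then 1 else 0) \<in> S"
    using assms(1) by (simp add: const_fun_def)
  have "ring (fun_star_algebra q S)"
  proof (rule ringI)
    show "abelian_group (fun_star_algebra q S)"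
    proof (rule abelian_groupI)
      fix f assume "f \<in> carrier (fun_star_algebra q S)"
      then show "\<exists>g\<in>carrier (fun_star_algebra q S). g \<oplus>\<^bsub>fun_star_algebra q S\<^esub> f = \<zero>\<^bsub>fun_star_algebra q S\<^esub>"
        using scale[of f "- 1"] by (intro bexI[of _ "\<lambda>z. - 1 * f z"]) (simp_all add: fun_star_algebra_def)
    qed (simp_all add: fun_star_algebra_def assms zero add_ac)
    show "monoid (fun_star_algebra q S)"
      by (rule monoidI) (auto simp: fun_star_algebra_def assms one mult_ac fun_eq_iff)
  qed (simp_all add: fun_star_algebra_def fun_eq_iff algebra_simps)
  then interpret ring "fun_star_algebra q S" .
  show ?thesis
    by unfold_locales (simp_all add: fun_star_algebra_def fun_eq_iff assms algebra_simps)
qed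

locale q_plane =
  fixes q :: real
  assumes q_pos: "0 < q" and q_less_1: "q < 1"
begin

section \<open>Circles, their orbits and entire continuations\<close>

lemma q_neq_0 [simp]: "q \<noteq> 0" "complex_of_real q \<noteq> 0"
  using q_pos by auto

lemma powi_pos [simp]: "0 < q powi n" "q powi n \<noteq> 0"
  using q_pos zero_less_power_int[of q n] by auto

lemma powi_add: "q powi (m + n) = q powi m * q powi n"
  by (simp add: power_int_add)

lemma powi_less_iff: "q powi m < q powi n \<longleftrightarrow> n < m"
  using power_int_strict_decreasing[of n m q] power_int_strict_decreasing[of m n q] q_pos q_less_1
  by (cases m n rule: linorder_cases) auto

lemma zero_notin_Gam [simp]: "0 \<notin> Gam q"
  by (auto simp: Gam_def dest: sym)

lemma zero_in_Gam_bar [simp]: "0 \<in> Gam_bar q"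
  by (simp add: Gam_bar_def)

lemma circle_in_Gam_bar: "norm z = q powi n \<Longrightarrow> z \<in> Gam_bar q"
  by (auto simp: Gam_def Gam_bar_def)

lemma circle_nonzero: "norm z = q powi n \<Longrightarrow> z \<noteq> 0"
  using powi_pos(1)[of n] by auto

lemma Gam_bar_cases:
  obtains "z = 0" | "z \<notin> Gam_bar q" | n where "norm z = q powi n"
  by (auto simp: Gam_def Gam_bar_def)

lemma at_0_within_Gam_bar: "at 0 within Gam_bar q = at 0 within Gam q"
  by (simp add: at_within_def Gam_bar_def)

lemma norm_scale: "norm (of_real (q powi k) * z) = q powi k * norm z" for z :: complex
  by (simp add: norm_mult norm_power_int abs_of_pos[OF q_pos])

lemma norm_rotate: "norm (of_real q powr (\<i> * of_real t)) = 1"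
  using q_pos by (simp add: norm_powr_real)

lemma scale_in_Gam_bar:
  assumes "norm u = 1" shows "u * of_real (q powi k) * z \<in> Gam_bar q \<longleftrightarrow> z \<in> Gam_bar q"
proof -
  have u: "u \<noteq> 0" using assms by auto
  have "norm (u * of_real (q powi k) * z) = q powi k * norm z"
    using assms norm_scale[of k z] by (simp add: norm_mult mult.assoc)
  moreover have "(\<exists>n. q powi k * norm z = q powi n) \<longleftrightarrow> (\<exists>n. norm z = q powi n)"
  proof
    assume "\<exists>n. q powi k * norm z = q powi n"
    then obtain n where "q powi k * norm z = q powi n" by blast
    then have "norm z = q powi (n - k)" by (simp add: power_int_diff field_simps)
    then show "\<exists>n. norm z = q powi n" by blast
  next
    assume "\<exists>n. norm z = q powi n"
    then obtain n where "norm z = q powi n" by blast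
    then have "q powi k * norm z = q powi (k + n)" by (simp add: powi_add)
    then show "\<exists>n. q powi k * norm z = q powi n" by blast
  qed
  ultimately show ?thesis
    using u by (auto simp: Gam_bar_def Gam_def)
qed

text \<open>By the identity theorem an entire function is determined by its values on the real line,
  0 being a limit point of it. The definite description in \<open>orbit_extension\<close> is thus
  met by any candidate that fits on the reals.\<close>

lemma orbit_extension_eqI:
  assumes "h holomorphic_on UNIV"
    and "\<And>t::real. h (of_real t) = f (of_real q powr (\<i> * of_real t) * z)"
  shows "orbit_extension q f z = h"
  unfolding orbit_extension_def
proof (rule the_equality)
  show "h holomorphic_on UNIV \<and> (\<forall>t::real. h (of_real t) = f (of_real q powr (\<i> * of_real t) * z))"
    using assms by blast
next
  fix g assume g: "g holomorphic_on UNIV \<and> (\<forall>t::real. g (of_real t) = f (of_real q powr (\<i> * of_real t) * z))"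
  have limpt: "0 islimpt range complex_of_real"
    unfolding islimpt_approachable
  proof (intro allI impI)
    fix e :: real assume "0 < e"
    then have "complex_of_real (e / 2) \<noteq> 0 \<and> dist (complex_of_real (e / 2)) 0 < e"
      by (simp add: norm_divide)
    then show "\<exists>x'\<in>range complex_of_real. x' \<noteq> 0 \<and> dist x' 0 < e"
      using rangeI[of complex_of_real "e / 2"] by (rule bexI)
  qed
  have "g w - h w = 0" for w
  proof (rule analytic_continuation[of "\<lambda>w. g w - h w" UNIV "range complex_of_real" 0])
    show "(\<lambda>w. g w - h w) holomorphic_on UNIV"
      using g assms(1) by (intro holomorphic_intros) auto
    show "g w - h w = 0" if "w \<in> range complex_of_real" for w
      using that g assms(2) by auto
  qed (use limpt connected_UNIV in auto)
  then show "g = h" by auto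
qed

text \<open>With w = q^k z, the function t |-> h(q^(it) w) is entire because its argument never
  reaches 0, and for real t that argument stays on the circle of index n + k, where h equals f. At t
  = -ie the factor q^(it) becomes q^e. The continuation is the one from the circle of q^k z, not
  from that of z.\<close>

lemma twist_circle:
  assumes z: "norm z = q powi n" and h: "h holomorphic_on - {0}"
    and hf: "\<And>w. norm w = q powi (n + k) \<Longrightarrow> h w = f w"
  shows "twist q e k f z = h (of_real (q powi (e + k)) * z)"
proof -
  define w where "w = of_real (q powi k) * z"
  have w: "norm w = q powi (n + k)"
    unfolding w_def norm_scale z by (simp add: powi_add)
  define H where "H t = h (of_real q powr (\<i> * t) * w)" for t
  have "orbit_extension q f w = H"
  proof (rule orbit_extension_eqI)
    have "(\<lambda>t. of_real q powr (\<i> * t) * w) holomorphic_on UNIV"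
      by (intro holomorphic_intros)
    moreover have "(\<lambda>t. of_real q powr (\<i> * t) * w) ` UNIV \<subseteq> - {0}"
      using circle_nonzero[OF w] by (auto simp: powr_def)
    ultimately have "(h \<circ> (\<lambda>t. of_real q powr (\<i> * t) * w)) holomorphic_on UNIV"
      using h by (metis holomorphic_on_compose_gen)
    then show "H holomorphic_on UNIV" by (simp add: H_def[abs_def] o_def)
    show "H (of_real t) = f (of_real q powr (\<i> * of_real t) * w)" for t :: real
      unfolding H_def by (rule hf) (simp add: norm_mult norm_rotate w)
  qed
  then have "twist q e k f z = H (- \<i> * of_int e)"
    by (simp add: twist_def w_def)
  also have "\<dots> = h (of_real (q powi (e + k)) * z)"
  proof -
    have "of_real q powr (\<i> * (- \<i> * of_int e)) = complex_of_real (q powi e)"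
      by (simp add: complex_powr_of_int)
    then show ?thesis by (simp add: H_def w_def powi_add mult.assoc)
  qed
  finally show ?thesis .
qed

lemma twist_0 [simp]: "twist q e k f 0 = f 0"
  unfolding twist_def by (subst orbit_extension_eqI[of "\<lambda>_. f 0"]) auto

lemma circ_hol_outside: "circ_hol q f \<Longrightarrow> z \<notin> Gam_bar q \<Longrightarrow> f z = 0"
  by (simp add: circ_hol_def)

lemma twist_outside:
  assumes f: "circ_hol q f" and z: "z \<notin> Gam_bar q"
  shows "twist q e k f z = 0"
proof -
  have "orbit_extension q f (of_real (q powi k) * z) = (\<lambda>_. 0)"
  proof (rule orbit_extension_eqI)
    fix t :: real
    show "0 = f (of_real q powr (\<i> * of_real t) * (of_real (q powi k) * z))"
      using circ_hol_outside[OF f, of "of_real q powr (\<i> * of_real t) * of_real (q powi k) * z"]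
        scale_in_Gam_bar[OF norm_rotate, of t k z] z by (simp add: mult.assoc)
  qed simp
  then show ?thesis by (simp add: twist_def)
qed

lemma circ_hol_extensions:
  assumes "circ_hol q f"
  obtains H where "\<And>n. H n holomorphic_on - {0}" "\<And>n z. norm z = q powi n \<Longrightarrow> H n z = f z"
  using assms unfolding circ_hol_def by metis

lemma circ_holI:
  assumes "\<And>z. z \<notin> Gam_bar q \<Longrightarrow> f z = 0"
    and "\<And>n. H n holomorphic_on - {0}" "\<And>n z. norm z = q powi n \<Longrightarrow> H n z = f z"
  shows "circ_hol q f"
  using assms unfolding circ_hol_def by metis

lemma fun_eq_GamI:
  assumes "f 0 = g 0" "\<And>z. z \<notin> Gam_bar q \<Longrightarrow> f z = 0" "\<And>z. z \<notin> Gam_bar q \<Longrightarrow> g z = 0"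
    and "\<And>n z. norm z = q powi n \<Longrightarrow> f z = g z"
  shows "f = g"
proof
  fix z show "f z = g z"
    by (cases z rule: Gam_bar_cases) (use assms in auto)
qed

section \<open>Operations that preserve continuation from the circles\<close>

lemma holomorphic_scale:
  assumes "h holomorphic_on - {0}" "c \<noteq> 0"
  shows "(\<lambda>z. h (c * z)) holomorphic_on - {0}"
proof -
  have "(h \<circ> (\<lambda>z. c * z)) holomorphic_on - {0}"
    by (rule holomorphic_on_compose_gen[OF _ assms(1)]) (use assms(2) in \<open>auto intro!: holomorphic_intros\<close>)
  then show ?thesis by (simp add: o_def)
qed

lemma circ_hol_twist:
  assumes "circ_hol q f" shows "circ_hol q (twist q e k f)"
proof -
  obtain H where H: "\<And>n. H n holomorphic_on - {0}" "\<And>n z. norm z = q powi n \<Longrightarrow> H n z = f z"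
    using circ_hol_extensions[OF assms] by blast
  show ?thesis
  \<comment> \<open>Circle n receives the continuation that belongs to circle n + k, at the argument
    scaled by q^(e + k).\<close>
  proof (rule circ_holI[where H = "\<lambda>n z. H (n + k) (of_real (q powi (e + k)) * z)"])
    show "H (n + k) (of_real (q powi (e + k)) * z) = twist q e k f z" if "norm z = q powi n" for n z
      using twist_circle[OF that H] by simp
  qed (use twist_outside[OF assms] in \<open>auto intro!: holomorphic_scale H\<close>)
qed

lemma circ_hol_add:
  assumes "circ_hol q f" "circ_hol q g" shows "circ_hol q (\<lambda>z. f z + g z)"
proof -
  obtain F where F: "\<And>n. F n holomorphic_on - {0}" "\<And>n z. norm z = q powi n \<Longrightarrow> F n z = f z"
    using circ_hol_extensions[OF assms(1)] by blast
  obtain G where G: "\<And>n. G n holomorphic_on - {0}" "\<And>n z. norm z = q powi n \<Longrightarrow> G n z = g z"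
    using circ_hol_extensions[OF assms(2)] by blast
  show ?thesis
    by (rule circ_holI[where H = "\<lambda>n z. F n z + G n z"])
      (use assms F G in \<open>auto intro!: holomorphic_intros simp: circ_hol_outside\<close>)
qed

lemma circ_hol_mult:
  assumes "circ_hol q f" "circ_hol q g" shows "circ_hol q (\<lambda>z. f z * g z)"
proof -
  obtain F where F: "\<And>n. F n holomorphic_on - {0}" "\<And>n z. norm z = q powi n \<Longrightarrow> F n z = f z"
    using circ_hol_extensions[OF assms(1)] by blast
  obtain G where G: "\<And>n. G n holomorphic_on - {0}" "\<And>n z. norm z = q powi n \<Longrightarrow> G n z = g z"
    using circ_hol_extensions[OF assms(2)] by blast
  show ?thesis
    by (rule circ_holI[where H = "\<lambda>n z. F n z * G n z"])
      (use assms F G in \<open>auto intro!: holomorphic_intros simp: circ_hol_outside\<close>)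
qed

lemma cnj_in_Gam_bar [simp]: "cnj z \<in> Gam_bar q \<longleftrightarrow> z \<in> Gam_bar q"
  by (auto simp: Gam_bar_def Gam_def)

lemma reflect_circle:
  assumes "norm z = q powi n" shows "cnj (of_real (q powi (2 * n)) / z) = z"
proof -
  have "z * cnj z = of_real ((norm z)\<^sup>2)"
    by (simp only: complex_norm_square)
  also have "(norm z)\<^sup>2 = q powi (2 * n)"
    by (simp add: assms power2_eq_square powi_add[symmetric])
  finally show ?thesis
    using circle_nonzero[OF assms] by (simp add: field_simps)
qed

text \<open>Schwarz reflection in the circle of radius \<open>r\<close>: the function \<open>cnj (h (r\<^sup>2 / cnj z))\<close> is
  holomorphic and agrees with \<open>cnj (h z)\<close> on the circle.\<close>

lemma circ_hol_cnj:
  assumes "circ_hol q f" shows "circ_hol q (\<lambda>z. cnj (f z))"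
proof -
  obtain H where H: "\<And>n. H n holomorphic_on - {0}" "\<And>n z. norm z = q powi n \<Longrightarrow> H n z = f z"
    using circ_hol_extensions[OF assms] by blast
  show ?thesis
  proof (rule circ_holI[where H = "\<lambda>n z. cnj (H n (cnj (of_real (q powi (2 * n)) / z)))"])
    fix n
    have "cnj ` (- {0}) = - {0}"
      by (auto intro!: image_eqI[of _ cnj "cnj x" for x])
    then have "(cnj \<circ> H n \<circ> cnj) holomorphic_on - {0}"
      by (intro holomorphic_on_compose_cnj_cnj) (simp_all add: H open_Compl)
    moreover have "(\<lambda>z. of_real (q powi (2 * n)) / z) holomorphic_on - {0}"
      by (intro holomorphic_intros) auto
    moreover have "(\<lambda>z. complex_of_real (q powi (2 * n)) / z) ` (- {0}) \<subseteq> - {0}"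
      by auto
    ultimately have "((cnj \<circ> H n \<circ> cnj) \<circ> (\<lambda>z. of_real (q powi (2 * n)) / z)) holomorphic_on - {0}"
      by (metis holomorphic_on_compose_gen)
    then show "(\<lambda>z. cnj (H n (cnj (of_real (q powi (2 * n)) / z)))) holomorphic_on - {0}"
      by (simp add: o_def)
  qed (simp add: circ_hol_outside[OF assms], simp only: reflect_circle H(2))
qed

section \<open>Algebraic rules for twists\<close>

lemma twist_add:
  assumes "circ_hol q f" "circ_hol q g"
  shows "twist q e k (\<lambda>z. f z + g z) = (\<lambda>z. twist q e k f z + twist q e k g z)"
proof (rule fun_eq_GamI)
  obtain F where F: "\<And>n. F n holomorphic_on - {0}" "\<And>n z. norm z = q powi n \<Longrightarrow> F n z = f z"
    using circ_hol_extensions[OF assms(1)] by blast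
  obtain G where G: "\<And>n. G n holomorphic_on - {0}" "\<And>n z. norm z = q powi n \<Longrightarrow> G n z = g z"
    using circ_hol_extensions[OF assms(2)] by blast
  fix n and z :: complex assume z: "norm z = q powi n"
  show "twist q e k (\<lambda>z. f z + g z) z = twist q e k f z + twist q e k g z"
    using twist_circle[OF z F] twist_circle[OF z G]
      twist_circle[OF z, of "\<lambda>z. F (n + k) z + G (n + k) z" k "\<lambda>z. f z + g z" e] F G
    by (simp add: holomorphic_intros)
qed (simp_all add: twist_outside circ_hol_add assms)

lemma twist_mult:
  assumes "circ_hol q f" "circ_hol q g"
  shows "twist q e k (\<lambda>z. f z * g z) = (\<lambda>z. twist q e k f z * twist q e k g z)"
proof (rule fun_eq_GamI)
  obtain F where F: "\<And>n. F n holomorphic_on - {0}" "\<And>n z. norm z = q powi n \<Longrightarrow> F n z = f z"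
    using circ_hol_extensions[OF assms(1)] by blast
  obtain G where G: "\<And>n. G n holomorphic_on - {0}" "\<And>n z. norm z = q powi n \<Longrightarrow> G n z = g z"
    using circ_hol_extensions[OF assms(2)] by blast
  fix n and z :: complex assume z: "norm z = q powi n"
  show "twist q e k (\<lambda>z. f z * g z) z = twist q e k f z * twist q e k g z"
    using twist_circle[OF z F] twist_circle[OF z G]
      twist_circle[OF z, of "\<lambda>z. F (n + k) z * G (n + k) z" k "\<lambda>z. f z * g z" e] F G
    by (simp add: holomorphic_intros)
qed (simp_all add: twist_outside circ_hol_mult assms)

lemma twist_twist:
  assumes "circ_hol q f"
  shows "twist q e k (twist q e' k' f) = twist q (e + e') (k + k') f"
proof (rule fun_eq_GamI)
  obtain F where F: "\<And>n. F n holomorphic_on - {0}" "\<And>n z. norm z = q powi n \<Longrightarrow> F n z = f z"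
    using circ_hol_extensions[OF assms(1)] by blast
  fix n and z :: complex assume z: "norm z = q powi n"
  \<comment> \<open>This continues the inner twist from the circle of index n + k; it draws on f at
    the circle of index n + k + k'.\<close>
  define h where "h z = F (n + k + k') (of_real (q powi (e' + k')) * z)" for z
  have "h holomorphic_on - {0}"
    unfolding h_def by (intro holomorphic_scale F) simp
  moreover have "h w = twist q e' k' f w" if "norm w = q powi (n + k)" for w
    unfolding h_def 
    using twist_circle[where n = "n + k" and k = k' and e = e' and f = f, OF that F(1) F(2)]
    by simp
  ultimately have "twist q e k (twist q e' k' f) z = h (of_real (q powi (e + k)) * z)"
    by (rule twist_circle[OF z])
  also have "\<dots> = twist q (e + e') (k + k') f z"

    using twist_circle[where n = n and k = "k + k'" and e = "e + e'" and f = f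
        and h = "F (n + k + k')", OF z F(1)] F(2)
    by (simp add: h_def power_int_add add_ac mult_ac)
  finally show "twist q e k (twist q e' k' f) z = twist q (e + e') (k + k') f z" .
qed (simp_all add: twist_outside circ_hol_twist assms)

lemma twist_id:
  assumes "circ_hol q f" shows "twist q 0 0 f = f"
proof (rule fun_eq_GamI)
  obtain F where F: "\<And>n. F n holomorphic_on - {0}" "\<And>n z. norm z = q powi n \<Longrightarrow> F n z = f z"
    using circ_hol_extensions[OF assms(1)] by blast
  show "twist q 0 0 f z = f z" if "norm z = q powi n" for n z
    using twist_circle[OF that F] F(2)[of z n] that by simp
qed (simp_all add: twist_outside circ_hol_outside assms)

text \<open>The conjugate of f is continued by reflecting the argument in a circle, and reflection
  turns the dilation by q^e into one by q^-e. The shift k only selects the circle and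
  survives.\<close>

lemma twist_cnj:
  assumes "circ_hol q f"
  shows "twist q e k (\<lambda>z. cnj (f z)) = (\<lambda>z. cnj (twist q (- e) k f z))"
proof (rule fun_eq_GamI)
  obtain F where F: "\<And>n. F n holomorphic_on - {0}" "\<And>n z. norm z = q powi n \<Longrightarrow> F n z = f z"
    using circ_hol_extensions[OF assms(1)] by blast
  fix n and z :: complex assume z: "norm z = q powi n"
  define h where "h z = cnj (F (n + k) (cnj (of_real (q powi (2 * (n + k))) / z)))" for z
  have "cnj ` (- {0}) = - {0}"
    by (auto intro!: image_eqI[of _ cnj "cnj x" for x])
  then have "(cnj \<circ> F (n + k) \<circ> cnj) holomorphic_on - {0}"
    by (intro holomorphic_on_compose_cnj_cnj) (simp_all add: F open_Compl)
  moreover have "(\<lambda>z. of_real (q powi (2 * (n + k))) / z) holomorphic_on - {0}"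
    by (intro holomorphic_intros) auto
  moreover have "(\<lambda>z. complex_of_real (q powi (2 * (n + k))) / z) ` (- {0}) \<subseteq> - {0}"
    by auto
  ultimately have "((cnj \<circ> F (n + k) \<circ> cnj) \<circ> (\<lambda>z. of_real (q powi (2 * (n + k))) / z)) holomorphic_on - {0}"
    by (metis holomorphic_on_compose_gen)
  then have "h holomorphic_on - {0}"
    by (simp add: h_def[abs_def] o_def)
  moreover have "h w = cnj (f w)" if "norm w = q powi (n + k)" for w
    using that by (simp only: h_def reflect_circle F(2))
  ultimately have "twist q e k (\<lambda>z. cnj (f z)) z = h (of_real (q powi (e + k)) * z)"
    by (rule twist_circle[OF z])
  \<comment> \<open>The reflection is in the circle of radius q^(n + k). Dividing q^(2n + 2k) by
    q^(e + k) leaves q^(k - e) times q^(2n), and q^(2n) reflects z to itself.\<close>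
  also have "cnj (of_real (q powi (2 * (n + k))) / (of_real (q powi (e + k)) * z)) =
      of_real (q powi (- e + k)) * cnj (of_real (q powi (2 * n)) / z)"
    by (simp add: power_int_add power_int_diff power_int_minus distrib_left field_simps power_int_mult power2_eq_square)
  then have "h (of_real (q powi (e + k)) * z) = cnj (F (n + k) (of_real (q powi (- e + k)) * z))"
    by (simp only: h_def reflect_circle[OF z])
  also have "\<dots> = cnj (twist q (- e) k f z)"
    using twist_circle[OF z F] by simp
  finally show "twist q e k (\<lambda>z. cnj (f z)) z = cnj (twist q (- e) k f z)" .
qed (simp_all add: twist_outside circ_hol_cnj assms)

section \<open>The q-derivatives as difference quotients\<close>

lemma derivs_eq_diff_quot:
  "dL_z q = diff_quot q 1 1 (1 - of_real (q\<^sup>2)) (\<lambda>z. z)"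
  "dR_z q = diff_quot q (- 1) (- 1) (1 - of_real (q powi (- 2))) (\<lambda>z. z)"
  "dL_zbar q = diff_quot q 1 (- 1) (1 - of_real (q powi (- 2))) cnj"
  "dR_zbar q = diff_quot q (- 1) 1 (1 - of_real (q\<^sup>2)) cnj"
proof -
  \<comment> \<open>Two of the derivatives carry q^-2 - 1; reversing both signs brings f to the
    front of the numerator.\<close>
  have *: "(a - b) / ((c - 1) * w) = (b - a) / ((1 - c) * w)" for a b c w :: complex
    by (metis minus_diff_eq minus_divide_divide mult_minus_left)
  show "dL_z q = diff_quot q 1 1 (1 - of_real (q\<^sup>2)) (\<lambda>z. z)"
    by (simp add: fun_eq_iff dL_z_def diff_quot_def twist_def qdot_def)
  show "dR_z q = diff_quot q (- 1) (- 1) (1 - of_real (q powi (- 2))) (\<lambda>z. z)"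
    unfolding fun_eq_iff dR_z_def diff_quot_def * by (simp add: twist_def qdot_inv_def power_int_minus field_simps)
  show "dL_zbar q = diff_quot q 1 (- 1) (1 - of_real (q powi (- 2))) cnj"
    unfolding fun_eq_iff dL_zbar_def diff_quot_def * by (simp add: twist_def qdot_def power_int_minus field_simps)
  show "dR_zbar q = diff_quot q (- 1) 1 (1 - of_real (q\<^sup>2)) cnj"
    by (simp add: fun_eq_iff dR_zbar_def diff_quot_def twist_def qdot_inv_def)
qed

lemma form_twist_eq: "form_twist q Om = twist q 1 1" "form_twist q Om_bar = twist q 1 (- 1)"
  by (simp_all add: fun_eq_iff twist_def qdot_def power_int_minus field_simps)

lemma denominators_nonzero [simp]:
  "1 - complex_of_real (q\<^sup>2) \<noteq> 0" "1 - complex_of_real (q powi (- 2)) \<noteq> 0"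
proof -
  have "q\<^sup>2 < 1" using q_pos q_less_1 by (simp add: power_less_one_iff)
  moreover have "1 < q powi (- 2)" using powi_less_iff[of 0 "- 2"] by simp
  ultimately have "1 - q\<^sup>2 \<noteq> 0" "1 - q powi (- 2) \<noteq> 0" by linarith+
  then have "complex_of_real (1 - q\<^sup>2) \<noteq> 0" "complex_of_real (1 - q powi (- 2)) \<noteq> 0"
    by (simp_all only: of_real_eq_0_iff not_False_eq_True)
  then show "1 - complex_of_real (q\<^sup>2) \<noteq> 0" "1 - complex_of_real (q powi (- 2)) \<noteq> 0"
    by (simp_all only: of_real_diff of_real_1 not_False_eq_True)
qed

text \<open>The clause e + k = 0 for \<open>cnj\<close> says that such a twist fixes z. Otherwise
  the derivative of z would be a nonzero multiple of z / \<open>cnj z\<close>, which has no limit at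
  0.\<close>

lemma q_derivs_cases:
  assumes "D \<in> q_derivs q"
  obtains e k c w where "D = diff_quot q e k c w" "c \<noteq> 0" "w = (\<lambda>z. z) \<or> w = cnj \<and> e + k = 0"
  using assms denominators_nonzero unfolding q_derivs_def derivs_eq_diff_quot
  by (elim insertE emptyE) (metis add.left_inverse add.right_inverse)+

text \<open>Conjugation reverses e, conjugates w and keeps the real normalising constant. It thus
  pairs \<open>dR_z\<close> with \<open>dL_zbar\<close> and \<open>dL_z\<close> with
  \<open>dR_zbar\<close>.\<close>

lemma q_derivs_cnj:
  assumes "D \<in> q_derivs q"
  obtains D' where "D' \<in> q_derivs q" "\<And>f. circ_hol q f \<Longrightarrow> D (\<lambda>z. cnj (f z)) = (\<lambda>z. cnj (D' f z))"
proof -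
  have *: "diff_quot q e k (1 - of_real c) w (\<lambda>z. cnj (f z)) = (\<lambda>z. cnj (diff_quot q (- e) k (1 - of_real c) w' f z))"
    if "circ_hol q f" "\<And>z. w' z = cnj (w z)" for f e k c w w'
    using that by (simp add: diff_quot_def twist_cnj)
  have **: "\<exists>D'\<in>q_derivs q. \<forall>f. circ_hol q f \<longrightarrow> D (\<lambda>z. cnj (f z)) = (\<lambda>z. cnj (D' f z))"
    using assms[unfolded q_derivs_def]
  proof (elim insertE emptyE)
    assume "D = dR_z q"
    then show ?thesis unfolding q_derivs_def
      by (intro bexI[of _ "dL_zbar q"]) (auto simp: derivs_eq_diff_quot * simp del: of_real_power of_real_power_int)
  next
    assume "D = dL_z q"
    then show ?thesis unfolding q_derivs_def
      by (intro bexI[of _ "dR_zbar q"]) (auto simp: derivs_eq_diff_quot * simp del: of_real_power of_real_power_int)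
  next
    assume "D = dL_zbar q"
    then show ?thesis unfolding q_derivs_def
      by (intro bexI[of _ "dR_z q"]) (auto simp: derivs_eq_diff_quot * simp del: of_real_power of_real_power_int)
  next
    assume "D = dR_zbar q"
    then show ?thesis unfolding q_derivs_def
      by (intro bexI[of _ "dL_z q"]) (auto simp: derivs_eq_diff_quot * simp del: of_real_power of_real_power_int)
  qed
  then show ?thesis using that by blast
qed

section \<open>Holomorphy of difference quotients; changes at the origin\<close>

lemma circ_hol_const: "circ_hol q (const_fun q c)"
  by (rule circ_holI[where H = "\<lambda>_ _. c"]) (auto simp: const_fun_def dest: circle_in_Gam_bar)

lemma circ_hol_bz: "circ_hol q (bz q)"
  by (rule circ_holI[where H = "\<lambda>_ z. z"]) (auto simp: bz_def dest: circle_in_Gam_bar)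

lemma bzbar_eq: "bzbar q = (\<lambda>z. cnj (bz q z))"
  by (auto simp: bz_def bzbar_def)

lemma circ_hol_cong:
  assumes "circ_hol q f" "\<And>z. z \<noteq> 0 \<Longrightarrow> g z = f z" shows "circ_hol q g"
proof -
  obtain F where F: "\<And>n. F n holomorphic_on - {0}" "\<And>n z. norm z = q powi n \<Longrightarrow> F n z = f z"
    using circ_hol_extensions[OF assms(1)] by blast
  show ?thesis
  proof (rule circ_holI[where H = F])
    show "g z = 0" if "z \<notin> Gam_bar q" for z
      using that assms zero_in_Gam_bar circ_hol_outside by metis
    show "F n z = g z" if "norm z = q powi n" for n z
      using that F(2) assms(2) circle_nonzero by metis
  qed (rule F)
qed

text \<open>Since \<open>circ_hol\<close> constrains nothing at 0, the reciprocals of the two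
  denominators satisfy it in spite of their pole, and the quotient is a product.\<close>

lemma circ_hol_diff_quot:
  assumes "circ_hol q f" "w = (\<lambda>z. z) \<or> w = cnj"
  shows "circ_hol q (diff_quot q e k c w f)"
proof -
  define v where "v = (\<lambda>z. if z \<in> Gam_bar q then 1 / (c * z) else 0)"
  have v: "circ_hol q v"
    unfolding v_def
    by (rule circ_holI[where H = "\<lambda>_ z. (1 / c) * (1 / z)"])
      (auto intro!: holomorphic_intros dest: circle_in_Gam_bar)
  define v' where "v' = (\<lambda>z. if z \<in> Gam_bar q then 1 / (c * cnj z) else 0)"
  \<comment> \<open>The function 1 / (c \<open>cnj z\<close>) is the conjugate of 1 /
    (\<open>cnj c\<close> z), which is holomorphic off 0.\<close>
  have "circ_hol q (\<lambda>z. cnj (if z \<in> Gam_bar q then 1 / (cnj c * z) else 0))"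
    by (rule circ_hol_cnj, rule circ_holI[where H = "\<lambda>_ z. (1 / cnj c) * (1 / z)"])
      (auto intro!: holomorphic_intros dest: circle_in_Gam_bar)
  also have "(\<lambda>z. cnj (if z \<in> Gam_bar q then 1 / (cnj c * z) else 0)) = v'"
    by (auto simp: v'_def)
  finally have v': "circ_hol q v'" .
  have diff: "circ_hol q (\<lambda>z. f z + const_fun q (- 1) z * twist q e k f z)"
    by (intro circ_hol_add circ_hol_mult circ_hol_const circ_hol_twist assms)
  have f0: "z \<notin> Gam_bar q \<Longrightarrow> f z = 0" "z \<notin> Gam_bar q \<Longrightarrow> twist q e k f z = 0" for z
    using assms(1) by (auto simp: circ_hol_outside twist_outside)
  from assms(2) show ?thesis
  proof
    assume "w = (\<lambda>z. z)"
    then have "diff_quot q e k c w f = (\<lambda>z. (f z + const_fun q (- 1) z * twist q e k f z) * v z)"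
      by (auto simp: diff_quot_def v_def const_fun_def f0)
    then show ?thesis using circ_hol_mult[OF diff v] by simp
  next
    assume "w = cnj"
    then have "diff_quot q e k c w f = (\<lambda>z. (f z + const_fun q (- 1) z * twist q e k f z) * v' z)"
      by (auto simp: diff_quot_def v'_def const_fun_def f0)
    then show ?thesis using circ_hol_mult[OF diff v'] by simp
  qed
qed

lemma circ_hol_deriv:
  assumes "circ_hol q f" "D \<in> q_derivs q" shows "circ_hol q (D f)"
  using assms(2) by (rule q_derivs_cases) (use circ_hol_diff_quot[OF assms(1)] in auto)

lemma twist_cong:
  assumes "\<And>z. z \<noteq> 0 \<Longrightarrow> f z = g z" "z \<noteq> 0"
  shows "twist q e k f z = twist q e k g z"
proof -
  have "f (of_real q powr (\<i> * of_real t) * (of_real (q powi k) * z)) =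
      g (of_real q powr (\<i> * of_real t) * (of_real (q powi k) * z))" for t :: real
    by (rule assms(1)) (use assms(2) in \<open>simp add: powr_def\<close>)
  then show ?thesis by (simp add: twist_def orbit_extension_def)
qed

text \<open>The orbit of a nonzero point avoids 0, and at 0 itself both sides have the default value
  0. The conclusion is therefore an equality of functions.\<close>

lemma deriv_cong:
  assumes "D \<in> q_derivs q" "\<And>z. z \<noteq> 0 \<Longrightarrow> f z = g z"
  shows "D f = D g"
proof -
  obtain e k c w where D: "D = diff_quot q e k c w" "w = (\<lambda>z. z) \<or> w = cnj"
    using q_derivs_cases[OF assms(1)] by metis
  show ?thesis
  proof
    fix z show "D f z = D g z"
      using assms(2) twist_cong[of f g z e k, OF assms(2)] D
      by (cases "z = 0") (auto simp: diff_quot_def)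
  qed
qed

section \<open>Leibniz rule and twisted coordinates\<close>

lemma diff_quot_add:
  assumes "circ_hol q f" "circ_hol q g"
  shows "diff_quot q e k c w (\<lambda>z. f z + g z) = (\<lambda>z. diff_quot q e k c w f z + diff_quot q e k c w g z)"
  unfolding diff_quot_def twist_add[OF assms] add_divide_distrib[symmetric] by (simp add: algebra_simps)

text \<open>With T multiplicative, f g - (T f)(T g) = (f - T f) g + (T f)(g - T g).\<close>

lemma diff_quot_mult:
  assumes "circ_hol q f" "circ_hol q g"
  shows "diff_quot q e k c w (\<lambda>z. f z * g z) =
    (\<lambda>z. diff_quot q e k c w f z * g z + twist q e k f z * diff_quot q e k c w g z)"
  unfolding diff_quot_def twist_mult[OF assms] times_divide_eq_left times_divide_eq_right
    add_divide_distrib[symmetric] by (simp add: algebra_simps)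

lemma twist_eq_diff_quot:
  assumes "c \<noteq> 0" "w = (\<lambda>z. z) \<or> w = cnj"
  shows "twist q e k f z = f z - c * w z * diff_quot q e k c w f z"
  using assms by (cases "z = 0") (auto simp: diff_quot_def)

text \<open>The definition of the quotient solved for T f, with every factor written as a function
  supported on \<open>Gam_bar q\<close> so that closure under sums and products applies. At 0 the
  coordinate vanishes and T fixes the value.\<close>

lemma twist_eq_coordinate:
  assumes "circ_hol q f" "c \<noteq> 0" "w = (\<lambda>z. z) \<and> b = bz q \<or> w = cnj \<and> b = bzbar q"
  shows "twist q e k f = (\<lambda>z. f z + const_fun q (- c) z * b z * diff_quot q e k c w f z)"
proof
  fix z
  show "twist q e k f z = f z + const_fun q (- c) z * b z * diff_quot q e k c w f z"
  proof (cases "z \<in> Gam_bar q")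
    case True
    then show ?thesis
      using assms(3) twist_eq_diff_quot[OF assms(2), of w e k f z]
      by (auto simp: const_fun_def bz_def bzbar_def)
  next
    case False
    then show ?thesis
      using assms(1) by (simp add: twist_outside circ_hol_outside const_fun_def)
  qed
qed

lemma twist_const: "twist q e k (const_fun q c) = const_fun q c"
proof (rule fun_eq_GamI)
  show "twist q e k (const_fun q c) z = const_fun q c z" if "norm z = q powi n" for n z
    using twist_circle[OF that, of "\<lambda>_. c" k "const_fun q c" e] that
    by (simp add: const_fun_def circle_in_Gam_bar)
qed (auto simp: circ_hol_outside circ_hol_const twist_outside)

text \<open>Hence the twist (1, -1) of \<open>\<omega>_bar\<close> fixes z. By conjugation the
  exponent for the other coordinate is k - e, so the twist (1, 1) of \<open>\<omega>\<close> fixes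
  that one.\<close>

lemma twist_bz: "twist q e k (bz q) = (\<lambda>z. of_real (q powi (e + k)) * bz q z)"
proof (rule fun_eq_GamI)
  show "twist q e k (bz q) z = of_real (q powi (e + k)) * bz q z" if "norm z = q powi n" for n z
    using twist_circle[OF that, of "\<lambda>z. z" k "bz q" e] that
    by (simp add: bz_def circle_in_Gam_bar)
qed (auto simp: circ_hol_outside circ_hol_bz twist_outside, auto simp: bz_def)

lemma twist_bzbar: "twist q e k (bzbar q) = (\<lambda>z. of_real (q powi (k - e)) * bzbar q z)"
  unfolding bzbar_eq twist_cnj[OF circ_hol_bz] twist_bz by simp

subsection \<open>Smooth functions\<close>

lemma smooth_uptoD:
  "smooth_upto q n f \<Longrightarrow> circ_hol q f"
  "smooth_upto q n f \<Longrightarrow> \<exists>L. (f \<longlongrightarrow> L) (at 0 within Gam q)"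
  by (cases n; simp)+

lemma smooth_upto_SucD: "smooth_upto q (Suc n) f \<Longrightarrow> smooth_upto q n f"
  by (induction n arbitrary: f) simp_all

lemma tendsto_0_cong:
  "(\<And>z. z \<noteq> 0 \<Longrightarrow> f z = g z) \<Longrightarrow> (f \<longlongrightarrow> L) (at 0 within Gam q) \<longleftrightarrow> (g \<longlongrightarrow> L) (at 0 within Gam q)"
  by (rule Lim_cong_within) auto

lemma smooth_upto_cong:
  assumes "smooth_upto q n f" "\<And>z. z \<noteq> 0 \<Longrightarrow> g z = f z"
  shows "smooth_upto q n g"
  using assms circ_hol_cong[of f g] tendsto_0_cong[of g f] deriv_cong[of _ g f]
  by (cases n) auto

lemma smooth_upto_add:
  "smooth_upto q n f \<Longrightarrow> smooth_upto q n g \<Longrightarrow> smooth_upto q n (\<lambda>z. f z + g z)"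
proof (induction n arbitrary: f g)
  case 0
  then show ?case by (auto intro: circ_hol_add tendsto_add)
next
  case (Suc n)
  note c = smooth_uptoD(1)[OF Suc.prems(1)] smooth_uptoD(1)[OF Suc.prems(2)]
  have "smooth_upto q n (D (\<lambda>z. f z + g z))" if D: "D \<in> q_derivs q" for D
  proof -
    have "D (\<lambda>z. f z + g z) = (\<lambda>z. D f z + D g z)"
      using D by (rule q_derivs_cases) (simp add: diff_quot_add c)
    then show ?thesis using Suc D by simp
  qed
  then show ?case using Suc.prems by (auto intro: circ_hol_add tendsto_add)
qed

lemma tendsto_const_fun: "(const_fun q c \<longlongrightarrow> c) (at 0 within Gam q)"
  by (rule Lim_transform_within[OF tendsto_const, of 1]) (auto simp: const_fun_def Gam_bar_def)

lemma const_fun_0: "const_fun q 0 = (\<lambda>_. 0)"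
  by (auto simp: const_fun_def)

lemma smooth_upto_const: "smooth_upto q n (const_fun q c)"
proof (induction n arbitrary: c)
  case (Suc n)
  have "D (const_fun q c) = const_fun q 0" if "D \<in> q_derivs q" for D
    using that by (rule q_derivs_cases) (simp add: diff_quot_def twist_const const_fun_0)
  then show ?case using Suc tendsto_const_fun by (auto simp: circ_hol_const)
qed (use tendsto_const_fun circ_hol_const in auto)

lemma tendsto_bz: "(bz q \<longlongrightarrow> 0) (at 0 within Gam q)"
  by (rule Lim_transform_within[OF tendsto_ident_at, of 1]) (auto simp: bz_def Gam_bar_def)

lemma smooth_upto_bz: "smooth_upto q n (bz q)"
proof (cases n)
  case (Suc m)
  have "smooth_upto q m (D (bz q))" if "D \<in> q_derivs q" for D
    using that
  proof (rule q_derivs_cases)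
    fix e k c w assume D: "D = diff_quot q e k c w" and w: "w = (\<lambda>z. z) \<or> w = cnj \<and> e + k = 0"
    have eq: "D (bz q) z = (bz q z - of_real (q powi (e + k)) * bz q z) / (c * w z)" for z
      by (simp only: D diff_quot_def twist_bz)
    \<comment> \<open>The case e + k = 0 contains every quotient by \<open>cnj\<close>; in the
      remaining case w is z itself and cancels.\<close>
    show ?thesis
    proof (cases "e + k = 0")
      case True
      then have "D (bz q) = const_fun q 0"
        by (simp add: fun_eq_iff eq const_fun_0)
      then show ?thesis by (simp add: smooth_upto_const)
    next
      case False
      \<comment> \<open>This can hold only away from 0, where the quotient has its default value 0
        and not the constant.\<close>
      have "D (bz q) z = const_fun q ((1 - of_real (q powi (e + k))) / c) z" if "z \<noteq> 0" for z
      proof (cases "z \<in> Gam_bar q")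
        case True
        have "D (bz q) z = ((1 - of_real (q powi (e + k))) * z) / (c * z)"
          unfolding eq
          using w False True by (simp add: bz_def left_diff_distrib)
        also have "\<dots> = (1 - of_real (q powi (e + k))) / c"
          using that by simp
        finally show ?thesis using True by (simp add: const_fun_def)
      qed (subst eq, simp add: bz_def const_fun_def)
      then show ?thesis by (rule smooth_upto_cong[OF smooth_upto_const])
    qed
  qed
  then show ?thesis using Suc tendsto_bz circ_hol_bz by auto
qed (use tendsto_bz circ_hol_bz in auto)

lemma smooth_upto_cnj: "smooth_upto q n f \<Longrightarrow> smooth_upto q n (\<lambda>z. cnj (f z))"
proof (induction n arbitrary: f)
  case 0
  then show ?case by (auto intro: circ_hol_cnj tendsto_cnj)
next
  case (Suc n)
  have "smooth_upto q n (D (\<lambda>z. cnj (f z)))" if D: "D \<in> q_derivs q" for D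
    using D by (rule q_derivs_cnj) (use Suc in auto)
  then show ?case using Suc.prems by (auto intro: circ_hol_cnj tendsto_cnj)
qed

lemma smooth_upto_bzbar: "smooth_upto q n (bzbar q)"
  unfolding bzbar_eq by (rule smooth_upto_cnj[OF smooth_upto_bz])

text \<open>The twist of \<open>f\<close> differs from \<open>f\<close> by a coordinate times a difference quotient, hence it is
  again smooth, and the twisted Leibniz rule keeps the induction going.\<close>

lemma smooth_upto_mult:
  "smooth_upto q n f \<Longrightarrow> smooth_upto q n g \<Longrightarrow> smooth_upto q n (\<lambda>z. f z * g z)"
proof (induction n arbitrary: f g)
  case 0
  then show ?case by (auto intro: circ_hol_mult tendsto_mult)
next
  case (Suc n)
  note c = smooth_uptoD(1)[OF Suc.prems(1)] smooth_uptoD(1)[OF Suc.prems(2)]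
  note s = smooth_upto_SucD[OF Suc.prems(1)] smooth_upto_SucD[OF Suc.prems(2)]
  have "smooth_upto q n (D (\<lambda>z. f z * g z))" if D: "D \<in> q_derivs q" for D
    using D
  proof (rule q_derivs_cases)
    fix e k b w assume D': "D = diff_quot q e k b w" and "b \<noteq> 0" and w: "w = (\<lambda>z. z) \<or> w = cnj \<and> e + k = 0"
    define v where "v = (if w = (\<lambda>z. z) then bz q else bzbar q)"
    have v: "w = (\<lambda>z. z) \<and> v = bz q \<or> w = cnj \<and> v = bzbar q"
      using w by (auto simp: v_def)
    have "smooth_upto q n v"
      by (simp add: v_def smooth_upto_bz smooth_upto_bzbar)
    \<comment> \<open>The twist is needed one level below f. There its derivative term has the right
      level and the induction hypothesis covers the products, so there is no circularity.\<close>
    then have "smooth_upto q n (twist q e k f)"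
      unfolding twist_eq_coordinate[OF c(1) \<open>b \<noteq> 0\<close> v]
      using Suc.prems(1) D s by (auto simp: D' intro!: smooth_upto_add Suc.IH smooth_upto_const)
    then have "smooth_upto q n (\<lambda>z. D f z * g z + twist q e k f z * D g z)"
      using Suc.prems D s by (auto intro!: smooth_upto_add Suc.IH)
    then show ?thesis
      by (simp only: D' diff_quot_mult[OF c])
  qed
  then show ?case using Suc.prems by (auto intro: circ_hol_mult tendsto_mult)
qed

text \<open>The circles are isolated from each other, and near a point of one of them f agrees with
  a holomorphic function, so continuity there is automatic. The condition at the origin, where the
  circles accumulate, remains.\<close>

lemma B_set_iff: "f \<in> B_set q \<longleftrightarrow> circ_hol q f \<and> (f \<longlongrightarrow> f 0) (at 0 within Gam q)"
proof -
  have "continuous (at z within Gam_bar q) f" if f: "circ_hol q f" and z: "norm z = q powi n" for z n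
  proof -
    obtain F where F: "\<And>n. F n holomorphic_on - {0}" "\<And>n z. norm z = q powi n \<Longrightarrow> F n z = f z"
      using circ_hol_extensions[OF f] by blast
    have "isCont (F n) z"
      using holomorphic_on_imp_continuous_on[OF F(1), of n] circle_nonzero[OF z]
      by (simp add: continuous_on_eq_continuous_at open_Compl)
    then have cont: "continuous (at z within Gam_bar q) (F n)"
      by (rule continuous_at_imp_continuous_at_within)
    \<comment> \<open>The bound is the smaller of the gaps to the two neighbouring circles, which
      forces w onto circle n.\<close>
    have agree: "F n w = f w"
      if w: "w \<in> Gam_bar q" "dist w z < min (q powi n - q powi (n + 1)) (q powi (n - 1) - q powi n)" for w
    proof (rule F(2))
      have "\<bar>norm w - norm z\<bar> \<le> dist w z"
        by (simp add: dist_norm norm_triangle_ineq3)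
      then have less: "q powi (n + 1) < norm w" "norm w < q powi (n - 1)"
        using w(2) z by auto
      then have "w \<noteq> 0" using order.strict_trans[OF powi_pos(1) less(1)] by auto
      then obtain m where m: "norm w = q powi m"
        using w(1) by (auto simp: Gam_bar_def Gam_def)
      moreover have "m = n"
        using less by (simp add: m powi_less_iff)
      ultimately show "norm w = q powi n" by simp
    qed
    show ?thesis
    proof (rule continuous_transform_within[OF cont _ circle_in_Gam_bar[OF z]])
      show "0 < min (q powi n - q powi (n + 1)) (q powi (n - 1) - q powi n)"
        by (simp add: powi_less_iff)
    qed (rule agree)
  qed
  then have at_circle: "continuous (at z within Gam_bar q) f" if "circ_hol q f" "z \<in> Gam q" for z
    using that by (auto simp: Gam_def)
  have "continuous_on (Gam_bar q) f \<longleftrightarrow> (f \<longlongrightarrow> f 0) (at 0 within Gam q)" if "circ_hol q f"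
  proof -
    have "continuous_on (Gam_bar q) f \<longleftrightarrow> continuous (at 0 within Gam_bar q) f"
      using at_circle[OF that] unfolding continuous_on_eq_continuous_within by (auto simp: Gam_bar_def)
    then show ?thesis by (simp add: continuous_within at_0_within_Gam_bar)
  qed
  then show ?thesis
    by (auto simp: B_set_def circ_hol_def)
qed

lemma Cinf_set_iff: "f \<in> Cinf_set q \<longleftrightarrow> f \<in> B_set q \<and> (\<forall>n. smooth_upto q n f)"
proof -
  \<comment> \<open>Composition applies the last entry of a word first, so appending D matches the
    recursion of \<open>smooth_upto\<close>, which differentiates by D before the rest.\<close>
  have comp_snoc: "foldr (\<circ>) (Ds @ [D]) id f = foldr (\<circ>) Ds id (D f)" for Ds D and f :: "complex \<Rightarrow> complex"
    by (induction Ds) auto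
  have 1: "smooth_upto q n f"
    if "circ_hol q f" "\<forall>Ds\<in>lists (q_derivs q). \<exists>L. (foldr (\<circ>) Ds id f \<longlongrightarrow> L) (at 0 within Gam q)" for n f
    using that
  proof (induction n arbitrary: f)
    case 0
    then show ?case using bspec[OF 0(2), of "[]"] by simp
  next
    case (Suc n)
    have "smooth_upto q n (D f)" if D: "D \<in> q_derivs q" for D
    proof (rule Suc.IH)
      show "\<forall>Ds\<in>lists (q_derivs q). \<exists>L. (foldr (\<circ>) Ds id (D f) \<longlongrightarrow> L) (at 0 within Gam q)"
      proof
        fix Ds assume "Ds \<in> lists (q_derivs q)"
        then have "Ds @ [D] \<in> lists (q_derivs q)" using D by auto
        from bspec[OF Suc.prems(2) this] show "\<exists>L. (foldr (\<circ>) Ds id (D f) \<longlongrightarrow> L) (at 0 within Gam q)"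
          by (simp only: comp_snoc)
      qed
    qed (rule circ_hol_deriv[OF Suc.prems(1) D])
    moreover have "\<exists>L. (f \<longlongrightarrow> L) (at 0 within Gam q)"
      using bspec[OF Suc.prems(2), of "[]"] by simp
    ultimately show ?case using Suc.prems(1) by simp
  qed
  have 2: "\<exists>L. (foldr (\<circ>) Ds id f \<longlongrightarrow> L) (at 0 within Gam q)"
    if "set Ds \<subseteq> q_derivs q" "\<forall>n. smooth_upto q n f" for Ds f
    using that
  proof (induction Ds arbitrary: f rule: rev_induct)
    case Nil
    then show ?case using smooth_uptoD(2)[OF spec[OF Nil.prems(2), of 0]] by simp
  next
    case (snoc D Ds)
    have "smooth_upto q n (D f)" for n
      using snoc.prems spec[OF snoc.prems(2), of "Suc n"] by simp
    then show ?case
      unfolding comp_snoc using snoc.prems(1) by (intro snoc.IH) auto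
  qed
  show ?thesis
    unfolding Cinf_set_def q_derivs_def[symmetric]
    using 1[of f] 2[of _ f] by (auto simp: B_set_iff in_lists_conv_set subset_eq)
qed

lemma Cinf_setI:
  assumes "\<And>n. smooth_upto q n f" "(f \<longlongrightarrow> f 0) (at 0 within Gam q)"
  shows "f \<in> Cinf_set q"
  using assms smooth_uptoD(1)[OF assms(1)] by (simp add: Cinf_set_iff B_set_iff)

lemma Cinf_setD:
  assumes "f \<in> Cinf_set q"
  shows "smooth_upto q n f" "(f \<longlongrightarrow> f 0) (at 0 within Gam q)" "circ_hol q f"
  using assms by (simp_all add: Cinf_set_iff B_set_iff)

lemma Cinf_add: "f \<in> Cinf_set q \<Longrightarrow> g \<in> Cinf_set q \<Longrightarrow> (\<lambda>z. f z + g z) \<in> Cinf_set q"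
  by (intro Cinf_setI smooth_upto_add tendsto_add) (auto intro: Cinf_setD)

lemma Cinf_mult: "f \<in> Cinf_set q \<Longrightarrow> g \<in> Cinf_set q \<Longrightarrow> (\<lambda>z. f z * g z) \<in> Cinf_set q"
  by (intro Cinf_setI smooth_upto_mult tendsto_mult) (auto intro: Cinf_setD)

lemma Cinf_cnj: "f \<in> Cinf_set q \<Longrightarrow> (\<lambda>z. cnj (f z)) \<in> Cinf_set q"
  by (intro Cinf_setI smooth_upto_cnj tendsto_cnj) (auto intro: Cinf_setD)

lemma Cinf_const: "const_fun q c \<in> Cinf_set q"
  using tendsto_const_fun[of c] by (intro Cinf_setI smooth_upto_const) (simp add: const_fun_def[of q c])

lemma Cinf_bz: "bz q \<in> Cinf_set q"
  using tendsto_bz by (intro Cinf_setI smooth_upto_bz) (simp add: bz_def[of q])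

lemma Cinf_bzbar: "bzbar q \<in> Cinf_set q"
  unfolding bzbar_eq by (rule Cinf_cnj[OF Cinf_bz])

lemma Cinf_deriv_extension:
  assumes f: "f \<in> Cinf_set q" and D: "D \<in> q_derivs q"
  obtains g where "g \<in> Cinf_set q" "\<And>z. z \<noteq> 0 \<Longrightarrow> g z = D f z"
proof -
  have s: "smooth_upto q n (D f)" for n
    using Cinf_setD(1)[OF f, of "Suc n"] D by simp
  obtain L where L: "(D f \<longlongrightarrow> L) (at 0 within Gam q)"
    using smooth_uptoD(2)[OF s[of 0]] by blast
  define g where "g = (D f)(0 := L)"
  have g: "g z = D f z" if "z \<noteq> 0" for z
    using that by (simp add: g_def)
  have "g \<in> Cinf_set q"
  proof (rule Cinf_setI)
    show "smooth_upto q n g" for n by (rule smooth_upto_cong[OF s g])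
    show "(g \<longlongrightarrow> g 0) (at 0 within Gam q)"
      using L tendsto_0_cong[of g "D f" L] g by (simp add: g_def)
  qed
  then show ?thesis using that g by blast
qed

subsection \<open>The calculus\<close>

lemma B_setI: "circ_hol q f \<Longrightarrow> (f \<longlongrightarrow> f 0) (at 0 within Gam q) \<Longrightarrow> f \<in> B_set q"
  by (simp add: B_set_iff)

lemma B_add: "f \<in> B_set q \<Longrightarrow> g \<in> B_set q \<Longrightarrow> (\<lambda>z. f z + g z) \<in> B_set q"
  by (intro B_setI circ_hol_add tendsto_add) (simp_all add: B_set_iff)

lemma B_mult: "f \<in> B_set q \<Longrightarrow> g \<in> B_set q \<Longrightarrow> (\<lambda>z. f z * g z) \<in> B_set q"
  by (intro B_setI circ_hol_mult tendsto_mult) (simp_all add: B_set_iff)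

lemma B_cnj: "f \<in> B_set q \<Longrightarrow> (\<lambda>z. cnj (f z)) \<in> B_set q"
  by (intro B_setI circ_hol_cnj tendsto_cnj) (simp_all add: B_set_iff)

lemma Cinf_subset_B: "Cinf_set q \<subseteq> B_set q"
  by (auto simp: Cinf_set_iff)

lemma B_outside: "f \<in> B_set q \<Longrightarrow> z \<notin> Gam_bar q \<Longrightarrow> f z = 0"
  by (simp add: B_set_def)

lemma scale_eq_const_mult: "f \<in> B_set q \<Longrightarrow> (\<lambda>z. c * f z) = (\<lambda>z. const_fun q c z * f z)"
  by (auto simp: const_fun_def B_outside)

lemma complex_star_algebra_B: "complex_star_algebra (B_alg q)"
  unfolding B_alg_def using Cinf_const Cinf_subset_B
  by (intro complex_star_algebra_fun) (auto intro: B_add B_mult B_cnj simp: B_outside scale_eq_const_mult)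

lemma complex_star_algebra_Cinf: "complex_star_algebra (Cinf_alg q)"
  unfolding Cinf_alg_def using Cinf_subset_B
  by (intro complex_star_algebra_fun)
    (auto intro: Cinf_add Cinf_mult Cinf_cnj Cinf_const simp: B_outside scale_eq_const_mult subset_eq)

lemma Cinf_alg_eq: "Cinf_alg q = (B_alg q)\<lparr>carrier := Cinf_set q\<rparr>"
  by (simp add: Cinf_alg_def B_alg_def fun_star_algebra_def)

lemma B_alg_simps [simp]:
  "carrier (B_alg q) = B_set q" "f \<oplus>\<^bsub>B_alg q\<^esub> g = (\<lambda>z. f z + g z)" "f \<otimes>\<^bsub>B_alg q\<^esub> g = (\<lambda>z. f z * g z)"
  "star (B_alg q) f = (\<lambda>z. cnj (f z))"
  by (simp_all add: B_alg_def fun_star_algebra_def)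

text \<open>Here g is the derivative with its limit inserted at 0; the factor b vanishes there and
  hides the change. The remaining factor is grouped as the coefficient that reappears in the
  coordinate differential.\<close>

lemma coordinate_identity:
  assumes f: "f \<in> Cinf_set q" and D: "diff_quot q e k c w \<in> q_derivs q" and "c \<noteq> 0"
    and w: "w = (\<lambda>z. z) \<and> b = bz q \<or> w = cnj \<and> b = bzbar q"
  obtains g where "g \<in> Cinf_set q" "twist q e k f = (\<lambda>z. f z + g z * (const_fun q (- c) z * b z))"
proof -
  obtain g where g: "g \<in> Cinf_set q" "\<And>z. z \<noteq> 0 \<Longrightarrow> g z = diff_quot q e k c w f z"
    using Cinf_deriv_extension[OF f D] by blast
  have "g z * (const_fun q (- c) z * b z) = const_fun q (- c) z * b z * diff_quot q e k c w f z" for z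
    using g(2) w by (cases "z = 0") (auto simp: bz_def bzbar_def)
  then have "twist q e k f = (\<lambda>z. f z + g z * (const_fun q (- c) z * b z))"
    unfolding twist_eq_coordinate[OF Cinf_setD(3)[OF f] \<open>c \<noteq> 0\<close> w] by (simp only:)
  then show ?thesis using that g(1) by blast
qed

lemma twist_identities:
  assumes f: "f \<in> Cinf_set q"
  obtains g h where "g \<in> Cinf_set q" "h \<in> Cinf_set q"
    "twist q 1 1 f = (\<lambda>z. f z + g z * (const_fun q (of_real (q\<^sup>2) - 1) z * bz q z))"
    "twist q 1 (- 1) f = (\<lambda>z. f z + h z * (const_fun q (of_real (q powi (- 2)) - 1) z * bzbar q z))"
proof -
  have "diff_quot q 1 1 (1 - of_real (q\<^sup>2)) (\<lambda>z. z) \<in> q_derivs q"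
    "diff_quot q 1 (- 1) (1 - of_real (q powi (- 2))) cnj \<in> q_derivs q"
    by (simp_all add: q_derivs_def derivs_eq_diff_quot)
  note D = this
  obtain g where "g \<in> Cinf_set q"
    "twist q 1 1 f = (\<lambda>z. f z + g z * (const_fun q (- (1 - of_real (q\<^sup>2))) z * bz q z))"
    by (rule coordinate_identity[OF f D(1) denominators_nonzero(1)]) auto
  moreover obtain h where "h \<in> Cinf_set q"
    "twist q 1 (- 1) f = (\<lambda>z. f z + h z * (const_fun q (- (1 - of_real (q powi (- 2)))) z * bzbar q z))"
    by (rule coordinate_identity[OF f D(2) denominators_nonzero(2)]) auto
  ultimately show ?thesis
    using that[of g h] unfolding minus_diff_eq by blast
qed

text \<open>This makes the commutation relations applicable to every smooth function, and moves
  coefficients within the smooth algebra.\<close>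

lemma Cinf_twist:
  assumes "f \<in> Cinf_set q" shows "twist q 1 1 f \<in> Cinf_set q" "twist q 1 (- 1) f \<in> Cinf_set q"
proof -
  obtain g h where gh: "g \<in> Cinf_set q" "h \<in> Cinf_set q"
    "twist q 1 1 f = (\<lambda>z. f z + g z * (const_fun q (of_real (q\<^sup>2) - 1) z * bz q z))"
    "twist q 1 (- 1) f = (\<lambda>z. f z + h z * (const_fun q (of_real (q powi (- 2)) - 1) z * bzbar q z))"
    using twist_identities[OF assms] by blast
  show "twist q 1 1 f \<in> Cinf_set q" "twist q 1 (- 1) f \<in> Cinf_set q"
    unfolding gh(3,4) by (intro Cinf_add Cinf_mult Cinf_const Cinf_bz Cinf_bzbar assms gh(1,2))+
qed

text \<open>Conjugation reverses e and \<open>form_conj\<close> reverses k, so twisting the adjoint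
  of a twist undoes it.\<close>

sublocale TP: twisted_presentation "B_alg q" "form_twist q" form_conj
proof -
  interpret complex_star_algebra "B_alg q" by (rule complex_star_algebra_B)
  show "twisted_presentation (B_alg q) (form_twist q) form_conj"
  proof unfold_locales
    show "form_conj (form_conj x) = x" for x by (cases x) auto
    fix f x assume "f \<in> carrier (B_alg q)"
    then have f: "circ_hol q f" by (simp add: B_set_iff)
    show "form_twist q (form_conj x) (star (B_alg q) (form_twist q x f)) = star (B_alg q) f"
      using f by (cases x) (simp_all add: form_twist_eq twist_cnj circ_hol_twist twist_twist twist_id del: form_twist.simps)
  qed
qed

sublocale M: star_bimodule "B_alg q" "Omega_tilde q"
  unfolding Omega_tilde_def by (rule TP.star_bimodule_PB)

lemma generators:
  "\<omega> q \<in> carrier (Omega_tilde q)" "\<omega>_bar q \<in> carrier (Omega_tilde q)"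
  "invol (Omega_tilde q) (\<omega> q) = \<omega>_bar q" "invol (Omega_tilde q) (\<omega>_bar q) = \<omega> q"
  by (simp_all add: Omega_tilde_def \<omega>_def \<omega>_bar_def TP.generator_carrier TP.invol_generator)

lemma generator_commutation:
  "\<lbrakk>f \<in> B_set q; twist q 1 1 f \<in> B_set q\<rbrakk> \<Longrightarrow>
     \<omega> q \<triangleleft>\<^bsub>Omega_tilde q\<^esub> f = twist q 1 1 f \<triangleright>\<^bsub>Omega_tilde q\<^esub> \<omega> q"
  "\<lbrakk>f \<in> B_set q; twist q 1 (- 1) f \<in> B_set q\<rbrakk> \<Longrightarrow>
     \<omega>_bar q \<triangleleft>\<^bsub>Omega_tilde q\<^esub> f = twist q 1 (- 1) f \<triangleright>\<^bsub>Omega_tilde q\<^esub> \<omega>_bar q"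
  using TP.generator_twist[of f Om] TP.generator_twist[of f Om_bar]
  by (simp_all add: Omega_tilde_def \<omega>_def \<omega>_bar_def form_twist_eq del: form_twist.simps)

text \<open>The increments g and h lie in \<open>B_set q\<close>, hence so do the two twists of f
  and both relations apply. The parts f \<open>\<omega>\<close> and f \<open>\<omega>_bar\<close>
  then cancel in the commutator.\<close>

lemma qd_eq:
  assumes "f \<in> B_set q" "g \<in> B_set q" "h \<in> B_set q"
    and g: "twist q 1 1 f = (\<lambda>z. f z + g z)" and h: "twist q 1 (- 1) f = (\<lambda>z. f z + h z)"
  shows "qd q f = (g \<triangleright>\<^bsub>Omega_tilde q\<^esub> \<omega> q) \<ominus>\<^bsub>Omega_tilde q\<^esub> (h \<triangleright>\<^bsub>Omega_tilde q\<^esub> \<omega>_bar q)"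
proof -
  note [simp] = generators M.lact_closed M.ract_closed
  have tw: "(\<lambda>z. f z + g z) \<in> B_set q" "(\<lambda>z. f z + h z) \<in> B_set q"
    using assms(1-3) by (auto intro: B_add)
  have "\<omega> q \<triangleleft>\<^bsub>Omega_tilde q\<^esub> f = (f \<triangleright>\<^bsub>Omega_tilde q\<^esub> \<omega> q) \<oplus>\<^bsub>Omega_tilde q\<^esub> (g \<triangleright>\<^bsub>Omega_tilde q\<^esub> \<omega> q)"
    using generator_commutation(1)[of f] M.lact_add_left[of f g "\<omega> q"] assms(1,2) g tw by simp
  moreover have "\<omega>_bar q \<triangleleft>\<^bsub>Omega_tilde q\<^esub> f = (f \<triangleright>\<^bsub>Omega_tilde q\<^esub> \<omega>_bar q) \<oplus>\<^bsub>Omega_tilde q\<^esub> (h \<triangleright>\<^bsub>Omega_tilde q\<^esub> \<omega>_bar q)"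
    using generator_commutation(2)[of f] M.lact_add_left[of f h "\<omega>_bar q"] assms(1,3) h tw by simp
  moreover have "((a \<oplus>\<^bsub>Omega_tilde q\<^esub> b) \<ominus>\<^bsub>Omega_tilde q\<^esub> (c \<oplus>\<^bsub>Omega_tilde q\<^esub> d)) \<ominus>\<^bsub>Omega_tilde q\<^esub> (a \<ominus>\<^bsub>Omega_tilde q\<^esub> c)
      = b \<ominus>\<^bsub>Omega_tilde q\<^esub> d"
    if "a \<in> carrier (Omega_tilde q)" "b \<in> carrier (Omega_tilde q)" "c \<in> carrier (Omega_tilde q)"
      "d \<in> carrier (Omega_tilde q)" for a b c d
  proof -
    have "(a \<oplus>\<^bsub>Omega_tilde q\<^esub> b) \<ominus>\<^bsub>Omega_tilde q\<^esub> (c \<oplus>\<^bsub>Omega_tilde q\<^esub> d) =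
        (b \<ominus>\<^bsub>Omega_tilde q\<^esub> d) \<oplus>\<^bsub>Omega_tilde q\<^esub> (a \<ominus>\<^bsub>Omega_tilde q\<^esub> c)"
      using that by (simp add: a_minus_def M.M.minus_add M.M.a_ac)
    then show ?thesis
      using that by (simp add: M.M.minus_eq[of "b \<ominus>\<^bsub>Omega_tilde q\<^esub> d \<oplus>\<^bsub>Omega_tilde q\<^esub> (a \<ominus>\<^bsub>Omega_tilde q\<^esub> c)"]
        M.M.a_assoc M.M.r_neg)
  qed
  ultimately show ?thesis
    using assms(1-3) unfolding qd_def
    by (simp add: a_minus_def M.ract_add_left M.ract_minus M.lact_add_right M.lact_minus)
qed

text \<open>Each coordinate is fixed by one twist, so only one generator survives. The factors q^2 -
  1 and q^-2 - 1 are the scalings by the other twist, less 1.\<close>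

lemma qd_coordinates:
  "qd q (bz q) = (\<lambda>z. const_fun q (of_real (q\<^sup>2) - 1) z * bz q z) \<triangleright>\<^bsub>Omega_tilde q\<^esub> \<omega> q"
  "qd q (bzbar q) = \<ominus>\<^bsub>Omega_tilde q\<^esub> ((\<lambda>z. const_fun q (of_real (q powi (- 2)) - 1) z * bzbar q z) \<triangleright>\<^bsub>Omega_tilde q\<^esub> \<omega>_bar q)"
proof -
  have zero: "(\<lambda>z. 0) = \<zero>\<^bsub>B_alg q\<^esub>" by (simp add: B_alg_def fun_star_algebra_def)
  have B: "bz q \<in> B_set q" "bzbar q \<in> B_set q" "const_fun q c \<in> B_set q" "(\<lambda>z. 0) \<in> B_set q" for c
    using Cinf_subset_B Cinf_bz Cinf_bzbar Cinf_const Cinf_const[of 0] by (auto simp: const_fun_0)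
  have z: "twist q 1 1 (bz q) = (\<lambda>z. bz q z + const_fun q (of_real (q\<^sup>2) - 1) z * bz q z)"
    "twist q 1 (- 1) (bz q) = (\<lambda>z. bz q z + 0)"
    "twist q 1 (- 1) (bzbar q) = (\<lambda>z. bzbar q z + const_fun q (of_real (q powi (- 2)) - 1) z * bzbar q z)"
    "twist q 1 1 (bzbar q) = (\<lambda>z. bzbar q z + 0)"
    unfolding twist_bz twist_bzbar by (auto simp: const_fun_def bz_def bzbar_def algebra_simps)
  note [simp] = generators M.lact_closed M.lact_zero
  show "qd q (bz q) = (\<lambda>z. const_fun q (of_real (q\<^sup>2) - 1) z * bz q z) \<triangleright>\<^bsub>Omega_tilde q\<^esub> \<omega> q"
    using qd_eq[OF B(1) B_mult[OF B(3) B(1)] B(4) z(1,2)] B_mult[OF B(3) B(1)]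
    by (simp add: zero a_minus_def)
  show "qd q (bzbar q) = \<ominus>\<^bsub>Omega_tilde q\<^esub> ((\<lambda>z. const_fun q (of_real (q powi (- 2)) - 1) z * bzbar q z) \<triangleright>\<^bsub>Omega_tilde q\<^esub> \<omega>_bar q)"
    using qd_eq[OF B(2) B(4) B_mult[OF B(3) B(2)] z(4,3)] B_mult[OF B(3) B(2)]
    by (simp add: zero a_minus_def)
qed

theorem first_order_star_calculus_Omega1: "first_order_star_calculus (Cinf_alg q) (Omega1 q) (qd q)"
proof -
  note [simp] = generators M.lact_closed M.ract_closed
  have B: "f \<in> B_set q" if "f \<in> Cinf_set q" for f
    using that Cinf_subset_B by auto
  let ?u = "\<lambda>z. const_fun q (of_real (q\<^sup>2) - 1) z * bz q z"
  let ?v = "\<lambda>z. const_fun q (of_real (q powi (- 2)) - 1) z * bzbar q z"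
  have uv: "?u \<in> Cinf_set q" "?v \<in> Cinf_set q"
    by (intro Cinf_mult Cinf_const Cinf_bz Cinf_bzbar)+
  interpret C: complex_star_algebra "(B_alg q)\<lparr>carrier := Cinf_set q\<rparr>"
    using complex_star_algebra_Cinf by (simp add: Cinf_alg_eq)
  interpret K: inner_coordinate_calculus "B_alg q" "Omega_tilde q" "\<omega> q \<ominus>\<^bsub>Omega_tilde q\<^esub> \<omega>_bar q"
    "Cinf_set q" "bz q" "twist q 1 1" "twist q 1 (- 1)" "qd q"
  \<comment> \<open>The commutators with \<open>\<omega> q\<close> minus
    \<open>\<omega>_bar q\<close> in the goals are folded back to \<open>qd\<close>.\<close>
  proof (unfold_locales; (unfold qd_def[symmetric])?)
    show "invol (Omega_tilde q) (\<omega> q \<ominus>\<^bsub>Omega_tilde q\<^esub> \<omega>_bar q) = \<ominus>\<^bsub>Omega_tilde q\<^esub> (\<omega> q \<ominus>\<^bsub>Omega_tilde q\<^esub> \<omega>_bar q)"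
      by (simp add: a_minus_def M.invol_add M.invol_minus M.M.minus_add M.M.a_comm)
    fix f assume f: "f \<in> Cinf_set q"
    show "twist q 1 1 f \<in> Cinf_set q" "twist q 1 (- 1) f \<in> Cinf_set q"
      using f by (rule Cinf_twist)+
    note fB = B[OF f] B[OF Cinf_twist(1)[OF f]] B[OF Cinf_twist(2)[OF f]] B[OF uv(1)] B[OF uv(2)]
    \<comment> \<open>With dz = u \<open>\<omega>\<close>, commutativity of the function algebra
      gives u \<open>\<omega>\<close> f = u (T f) \<open>\<omega>\<close> = (T f) u
      \<open>\<omega>\<close>.\<close>
    show "qd q (bz q) \<triangleleft>\<^bsub>Omega_tilde q\<^esub> f = twist q 1 1 f \<triangleright>\<^bsub>Omega_tilde q\<^esub> qd q (bz q)"
      using fB by (simp add: qd_coordinates M.lact_ract generator_commutation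
          M.lact_mult[symmetric] mult_ac)
    show "qd q (star (B_alg q) (bz q)) \<triangleleft>\<^bsub>Omega_tilde q\<^esub> f =
        twist q 1 (- 1) f \<triangleright>\<^bsub>Omega_tilde q\<^esub> qd q (star (B_alg q) (bz q))"
      using fB by (simp add: bzbar_eq[symmetric] qd_coordinates M.ract_minus M.lact_minus M.lact_ract
          generator_commutation M.lact_mult[symmetric] mult_ac)
    obtain g h where gh: "g \<in> Cinf_set q" "h \<in> Cinf_set q"
      "twist q 1 1 f = (\<lambda>z. f z + g z * ?u z)" "twist q 1 (- 1) f = (\<lambda>z. f z + h z * ?v z)"
      using twist_identities[OF f] by blast
    \<comment> \<open>The increments of f are g u and h v, while dz = u \<open>\<omega>\<close> and
      the other differential is - v \<open>\<omega>_bar\<close>; its sign absorbs the minus in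
      \<open>qd_eq\<close>.\<close>
    have "qd q f = (g \<triangleright>\<^bsub>Omega_tilde q\<^esub> qd q (bz q)) \<oplus>\<^bsub>Omega_tilde q\<^esub>
        (h \<triangleright>\<^bsub>Omega_tilde q\<^esub> qd q (star (B_alg q) (bz q)))"
      using qd_eq[OF fB(1) B_mult[OF B[OF gh(1)] fB(4)] B_mult[OF B[OF gh(2)] fB(5)] gh(3,4)]
        M.lact_mult[OF _ _ generators(1), of g ?u] M.lact_mult[OF _ _ generators(2), of h ?v] fB(4,5) B[OF gh(1)] B[OF gh(2)]
      by (simp add: bzbar_eq[symmetric] qd_coordinates M.lact_minus a_minus_def)
    then show "\<exists>g\<in>Cinf_set q. \<exists>h\<in>Cinf_set q. qd q f = (g \<triangleright>\<^bsub>Omega_tilde q\<^esub> qd q (bz q)) \<oplus>\<^bsub>Omega_tilde q\<^esub>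
        (h \<triangleright>\<^bsub>Omega_tilde q\<^esub> qd q (star (B_alg q) (bz q)))"
      using gh(1,2) by blast
  qed (use Cinf_subset_B Cinf_bz in \<open>auto simp: qd_def[abs_def]\<close>)
  have "K.forms = Omega1_set q"
    unfolding K.forms_def Omega1_set_def qd_def[symmetric] by (simp add: bzbar_eq)
  then show ?thesis
    using K.first_order_star_calculus_forms unfolding qd_def[symmetric]
    by (simp add: Cinf_alg_eq Omega1_def)
qed

end

theorem proposition4p3:
  fixes q :: real
  assumes "0 < q" and "q < 1"
  shows "first_order_star_calculus (Cinf_alg q) (Omega1 q) (qd q)"
proof -
  interpret q_plane q using assms by unfold_locales
  show ?thesis by (rule first_order_star_calculus_Omega1)
qed

end
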